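(* Let $\alpha\in\mathbb{R}$, and let $\theta\in\mathbb{R}$ satisfy $\theta\in(-\infty,\tfrac12)$ if $\alpha\le 0$, and $\theta\in(-\infty,\tfrac12]$ if $\alpha>0$. Let the convolution weights $\{\omega_j\}_{j\ge0}$ be $$\omega_j=\Big[\frac{2(1-\theta)}{3-2\theta}\Big]^{\alpha}\sum_{k=0}^{j}\sum_{s=0}^{j-k}\kappa_k^{(1)}\kappa_s^{(2)}\kappa_{j-k-s}^{(3)},$$ $$\kappa_k^{(1)}=\Big(\frac{\theta}{1-\theta}\Big)^k\binom{\alpha}{k},\qquad \kappa_k^{(2)}=\Big(-\frac{1-2\theta}{3-2\theta}\Big)^k\binom{-\alpha}{k},\qquad \kappa_k^{(3)}=(-1)^k\binom{-\alpha}{k}.$$ Then the fractional convolution quadrature with weights $\omega_j$ is convergent (to $I^{\alpha}$) of order $2$.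
   Context: Generalized binomial coefficients: $\binom{a}{k}=a(a-1)\cdots(a-k+1)/k!$, $\binom{a}{0}=1$; $0^0=1$. The weights are the power series coefficients of $\omega(\xi)=\Big[\frac{1-\theta+\theta\xi}{(3/2-\theta)-(2-2\theta)\xi+(1/2-\theta)\xi^2}\Big]^{\alpha}$ at $\xi=0$ (the "fractional BT-$\theta$ method"). Fractional operators: for $\alpha>0$, $I^{\alpha}u(x)=\frac1{\Gamma(\alpha)}\int_0^x(x-s)^{\alpha-1}u(s)\,ds$; $I^0$ is the identity; for $\alpha>0$ and $n=\lceil\alpha\rceil$, $I^{-\alpha}u=\frac{d^n}{dx^n}I^{n-\alpha}u$. On powers, for $\beta\in\mathbb{C}\setminus\{-1,-2,\dots\}$ and every real $\alpha$, $(I^{\alpha}x^{\beta})(x)=\frac{\Gamma(\beta+1)}{\Gamma(\alpha+\beta+1)}x^{\alpha+\beta}$ for $x>0$ (by analytic continuation in $\beta$ where the integral diverges, with $1/\Gamma=0$ at the nonpositive integers). Grid: $x_n=nh$, $h>0$, $0\le x_n\le L$. Convergence of order 2: a convolution quadrature with weights $\{\omega_j\}$ is convergent (to $I^\alpha$) of order $2$ if for all $\beta\in\mathbb{C}\setminus\{-1,-2,\dots\}$, $$(I^{\alpha}x^{\beta})(x_n)-h^{\alpha}\sum_{j=0}^{n}\omega_{n-j}x_j^{\beta}=O(x_n^{\alpha+\beta-2}h^2)+O(x_n^{\alpha-1}h^{\beta+1}),$$ meaning that there is a constant $C$ (independent of $n\ge1$ and $h$) such that the absolute value of the left side is at most $C\big(x_n^{\alpha+\mathrm{Re}\beta-2}h^2+x_n^{\alpha-1}h^{\mathrm{Re}\beta+1}\big)$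 for all $n\ge1$, $h>0$ with $x_n\le L$. In the sum, the term $x_0^\beta=0^\beta$ is $0$ when $\beta\ne0$ and $1$ when $\beta=0$. *)

theory Defs
  imports "HOL-Analysis.Analysis"
begin

section \<open>Fractional integrals and derivatives\<close>

definition RL_integral :: "real \<Rightarrow> (real \<Rightarrow> complex) \<Rightarrow> real \<Rightarrow> complex" where
  "RL_integral \<alpha> u x =
     (if \<alpha> = 0 then u x
      else 1 / of_real (Gamma \<alpha>) * integral {0..x} (\<lambda>s. of_real ((x - s) powr (\<alpha> - 1)) * u s))"

text \<open>For negative order, \<open>n = \<lceil>-\<alpha>\<rceil>\<close> and the operator is the \<open>n\<close>-th derivative of the
  fractional integral of order \<open>n - (-\<alpha>) \<in> [0, 1)\<close>.\<close>

definition frac_op :: "real \<Rightarrow> (real \<Rightarrow> complex) \<Rightarrow> real \<Rightarrow> complex" where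
  "frac_op \<alpha> u =
     (if \<alpha> \<ge> 0 then RL_integral \<alpha> u
      else let n = nat \<lceil>-\<alpha>\<rceil>
           in ((\<lambda>f x. vector_derivative f (at x)) ^^ n) (RL_integral (real n + \<alpha>) u))"

text \<open>The library has \<open>0 powr 0 = 0\<close>, whereas here \<open>0\<^sup>0 = 1\<close>; for \<open>\<beta> \<noteq> 0\<close> the value at \<open>0\<close>
  is \<open>0\<close>, also if the real part of \<open>\<beta>\<close> is negative.\<close>

definition power_fun :: "complex \<Rightarrow> real \<Rightarrow> complex" where
  "power_fun \<beta> x = (if \<beta> = 0 then 1 else of_real x powr \<beta>)"

text \<open>If \<open>Re \<beta> > -1\<close>, the integral converges and the operator is applied as it stands. Otherwise
  the integral diverges at \<open>0\<close>, and the value is defined by analytic continuation in \<open>\<beta>\<close>: the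
  operator gives \<open>\<Gamma>(\<beta>+1) / \<Gamma>(\<alpha>+\<beta>+1) * x powr (\<alpha>+\<beta>)\<close> for \<open>Re \<beta> > -1\<close> and \<open>x > 0\<close> (Beta integral),
  and this expression is analytic in \<open>\<beta>\<close> off the negative integers.\<close>

definition frac_op_power :: "real \<Rightarrow> complex \<Rightarrow> real \<Rightarrow> complex" where
  "frac_op_power \<alpha> \<beta> x =
     (if Re \<beta> > -1 then frac_op \<alpha> (power_fun \<beta>) x
      else Gamma (\<beta> + 1) * rGamma (of_real \<alpha> + \<beta> + 1) * of_real x powr (of_real \<alpha> + \<beta>))"


section \<open>Convolution quadratures\<close>

definition conv_quad :: "(nat \<Rightarrow> real) \<Rightarrow> real \<Rightarrow> real \<Rightarrow> nat \<Rightarrow> (real \<Rightarrow> complex) \<Rightarrow> complex" where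
  "conv_quad \<omega> \<alpha> h n u =
     of_real (h powr \<alpha>) * (\<Sum>j=0..n. of_real (\<omega> (n - j)) * u (real j * h))"

definition convergent_of_order_2 :: "real \<Rightarrow> real \<Rightarrow> (nat \<Rightarrow> real) \<Rightarrow> bool" where
  "convergent_of_order_2 L \<alpha> \<omega> \<longleftrightarrow>
     (\<forall>\<beta>::complex. (\<forall>m::nat. m \<ge> 1 \<longrightarrow> \<beta> \<noteq> - of_nat m) \<longrightarrow>
       (\<exists>C::real. \<forall>n\<ge>1. \<forall>h>0. real n * h \<le> L \<longrightarrow>
          norm (frac_op_power \<alpha> \<beta> (real n * h) - conv_quad \<omega> \<alpha> h n (power_fun \<beta>))
            \<le> C * ((real n * h) powr (\<alpha> + Re \<beta> - 2) * h ^ 2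
                   + (real n * h) powr (\<alpha> - 1) * h powr (Re \<beta> + 1))))"


section \<open>The fractional BT-\<open>\<theta>\<close> method\<close>

definition kappa1 :: "real \<Rightarrow> real \<Rightarrow> nat \<Rightarrow> real" where
  "kappa1 \<alpha> \<theta> k = (\<theta> / (1 - \<theta>)) ^ k * (\<alpha> gchoose k)"

definition kappa2 :: "real \<Rightarrow> real \<Rightarrow> nat \<Rightarrow> real" where
  "kappa2 \<alpha> \<theta> k = (- ((1 - 2 * \<theta>) / (3 - 2 * \<theta>))) ^ k * ((- \<alpha>) gchoose k)"

definition kappa3 :: "real \<Rightarrow> nat \<Rightarrow> real" where
  "kappa3 \<alpha> k = (- 1) ^ k * ((- \<alpha>) gchoose k)"

definition bt_weight :: "real \<Rightarrow> real \<Rightarrow> nat \<Rightarrow> real" where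
  "bt_weight \<alpha> \<theta> j =
     (2 * (1 - \<theta>) / (3 - 2 * \<theta>)) powr \<alpha> *
     (\<Sum>k=0..j. \<Sum>s=0..j - k. kappa1 \<alpha> \<theta> k * kappa2 \<alpha> \<theta> s * kappa3 \<alpha> (j - k - s))"

end

theory Submission
  imports Defs
begin

unbundle no vec_syntax
unbundle fps_syntax

text \<open>
  Scaling out \<open>h\<close>, the error is the \<open>n\<close>-th coefficient of
  \<open>\<Gamma>(\<beta>+1)/\<Gamma>(\<alpha>+\<beta>+1) \<Sum> n powr (\<alpha>+\<beta>) X^n - \<omega>(X) \<Sum> n powr \<beta> X^n\<close>.
  The power sequence \<open>n powr \<beta>\<close> is expanded, up to an error decaying at any prescribed rate, in the
  coefficient sequences of \<open>(1-X) powr (i-\<beta>-1)\<close>, \<open>i = 0, 1, 2, \<dots>\<close>, which \<open>(1-X) powr (-\<alpha>)\<close>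
  multiplies exactly. Write \<open>\<omega>(X) = (1-X) powr (-\<alpha>) * g(X)\<close>. Consistency of order 2 is
  \<open>g(X) = 1 - \<alpha>/2 (1-X) + (1-X)^2 G(X)\<close>, and stability is the decay of the coefficients of \<open>G\<close>;
  with the two leading coefficients of the expansion of \<open>n powr \<beta>\<close> the terms of order
  \<open>\<alpha>+Re \<beta>\<close> and \<open>\<alpha>+Re \<beta>-1\<close> cancel, and the remainder contributes \<open>n powr (\<alpha>-1)\<close>.
\<close>

section \<open>Coefficients of power growth\<close>

text \<open>Two obstacles shape the proof. For \<theta> = 1/2 the factor g is a multiple of (1 + X)
  powr \<alpha>. Its singularity -1 lies on the unit circle, so its coefficients decay only like n
  powr (-\<alpha> - 1), and \<alpha> > 0 is what makes them summable. Forming difference quotients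
  at 1 must then cost no decay; absolute tail sums cannot show this, because the gain comes from
  alternating signs. For \<theta> < 1/2 the decay is geometric and crude bounds suffice. The second
  obstacle is the range of \<beta>: the powers may grow or decay, and Gamma factors may have poles.
  Hence \<open>rGamma\<close> replaces 1/\<Gamma>, and the expansion of n powr \<beta> is carried
  until its remainder is summable and can be convolved with the weights. The cancellation is one
  scalar identity: for \<beta> \<noteq> 0 the two leading coefficients are c0 = \<Gamma>(\<beta>+1)
  and c1 = -(\<beta>+1)/2 c0, and c0 (\<alpha>/2 - (\<alpha>+\<beta>+1)/2) - c1 = 0. Here \<alpha>/2
  is the derivative of g at 1, the same for every \<theta>.\<close>

definition growth :: "real \<Rightarrow> complex fps \<Rightarrow> bool" where
  "growth p F \<longleftrightarrow> (\<exists>C. \<forall>n. norm (F $ n) \<le> C * (1 + real n) powr p)"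

lemma growthI: "(\<And>n. norm (F $ n) \<le> C * (1 + real n) powr p) \<Longrightarrow> growth p F"
  unfolding growth_def by blast

lemma growthE:
  assumes "growth p F"
  obtains C where "C \<ge> 0" "\<And>n. norm (F $ n) \<le> C * (1 + real n) powr p"
proof -
  obtain C where C: "\<And>n. norm (F $ n) \<le> C * (1 + real n) powr p"
    using assms unfolding growth_def by blast
  moreover have "C \<ge> 0" using order_trans[OF norm_ge_zero C[of 0]] by simp
  ultimately show ?thesis using that by blast
qed

text \<open>The finitely many early coefficients enter the constant through their ratios to the
  weight, summed in \<open>D\<close>; \<open>C\<close> may be negative, hence its absolute
  value.\<close>

lemma growth_eventually:
  assumes "\<And>n. n \<ge> N \<Longrightarrow> norm (F $ n) \<le> C * (1 + real n) powr p"
  shows "growth p F"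
proof -
  define D where "D = (\<Sum>k<N. norm (F $ k) / (1 + real k) powr p)"
  have D: "D \<ge> 0" unfolding D_def by (intro sum_nonneg) auto
  show ?thesis
  proof (rule growthI[where C = "\<bar>C\<bar> + D"])
    fix n
    show "norm (F $ n) \<le> (\<bar>C\<bar> + D) * (1 + real n) powr p"
    proof (cases "n < N")
      case True
      have "norm (F $ n) / (1 + real n) powr p \<le> D" unfolding D_def
        by (rule member_le_sum[of n]) (use True in auto)
      hence "norm (F $ n) / (1 + real n) powr p \<le> \<bar>C\<bar> + D" by linarith
      thus ?thesis by (simp add: field_simps)
    next
      case False
      hence "norm (F $ n) \<le> C * (1 + real n) powr p" using assms by simp
      also have "\<dots> \<le> (\<bar>C\<bar> + D) * (1 + real n) powr p"
        by (rule mult_right_mono) (use D in auto)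
      finally show ?thesis .
    qed
  qed
qed

lemma growth_mono:
  assumes "growth p F" "p \<le> q"
  shows "growth q F"
proof -
  obtain C where C: "C \<ge> 0" "\<And>n. norm (F $ n) \<le> C * (1 + real n) powr p"
    using growthE[OF assms(1)] by blast
  have "norm (F $ n) \<le> C * (1 + real n) powr q" for n
    using C(2)[of n] mult_left_mono[OF powr_mono[OF assms(2), of "1 + real n"] C(1)] by simp
  thus ?thesis by (rule growthI)
qed

lemma growth_add:
  assumes "growth p F" "growth p G"
  shows "growth p (F + G)"
proof -
  obtain C where C: "\<And>n. norm (F $ n) \<le> C * (1 + real n) powr p"
    using growthE[OF assms(1)] by blast
  obtain D where D: "\<And>n. norm (G $ n) \<le> D * (1 + real n) powr p"
    using growthE[OF assms(2)] by blast
  show ?thesis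
  proof (rule growthI)
    fix n
    show "norm ((F + G) $ n) \<le> (C + D) * (1 + real n) powr p"
      using norm_triangle_le[OF add_mono[OF C[of n] D[of n]]] by (simp add: distrib_right)
  qed
qed

lemma growth_cmult:
  assumes "growth p F"
  shows "growth p (fps_const c * F)"
proof -
  obtain C where C: "\<And>n. norm (F $ n) \<le> C * (1 + real n) powr p"
    using growthE[OF assms(1)] by blast
  show ?thesis
    by (rule growthI[where C = "norm c * C"])
       (auto simp: norm_mult mult.assoc intro!: mult_left_mono C)
qed

lemma growth_uminus: "growth p F \<Longrightarrow> growth p (- F)"
  by (simp add: growth_def)

lemma growth_diff: "growth p F \<Longrightarrow> growth p G \<Longrightarrow> growth p (F - G)"
  using growth_add[of p F "- G"] growth_uminus[of p G] by simp

lemma growth_0: "growth p 0"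
  by (rule growthI[where C = 0]) simp

lemma growth_const: "growth p (fps_const c)"
  by (rule growth_eventually[where N = 1 and C = 0]) simp

lemma growth_sum:
  assumes "\<And>i. i \<in> I \<Longrightarrow> growth p (F i)"
  shows "growth p (\<Sum>i\<in>I. F i)"
  using assms by (induction I rule: infinite_finite_induct) (auto intro: growth_0 growth_add)

section \<open>Summability and Cauchy products\<close>

lemma summable_Suc_powr: "q < -1 \<Longrightarrow> summable (\<lambda>n. (1 + real n) powr q)"
  using summable_Suc_iff[of "\<lambda>n. real n powr q"] summable_real_powr_iff[of q] by simp

lemma growth_summable_norm:
  assumes "growth q F" "q < -1"
  shows "summable (\<lambda>n. norm (F $ n))"
proof -
  obtain C where C: "\<And>n. norm (F $ n) \<le> C * (1 + real n) powr q"
    using growthE[OF assms(1)] by blast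
  show ?thesis
    by (rule summable_comparison_test'[OF summable_mult[OF summable_Suc_powr[OF assms(2)], of C], of 0])
       (use C in auto)
qed

text \<open>Covers both signs of \<open>p\<close>: the upper bound on \<open>b\<close> serves
  \<open>p \<ge> 0\<close>, and the lower bound \<open>N / 2\<close> serves negative
  \<open>p\<close>, at the price of the power of 2.\<close>

lemma powr_half_le:
  fixes b N p :: real
  assumes "0 < N" "N / 2 \<le> b" "b \<le> N"
  shows "b powr p \<le> 2 powr \<bar>p\<bar> * N powr p"
proof -
  have b: "b > 0" using assms by linarith
  show ?thesis
  proof (cases "p \<ge> 0")
    case True
    have "b powr p \<le> N powr p" using b assms True by (intro powr_mono2) auto
    moreover have "1 \<le> (2::real) powr \<bar>p\<bar>" by (simp add: ge_one_powr_ge_zero)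
    ultimately show ?thesis
      by (metis mult_1 mult_right_mono order_trans powr_ge_zero)
  next
    case False
    have "b powr p \<le> (N / 2) powr p" using b assms False by (intro powr_mono2') auto
    also have "\<dots> = 2 powr \<bar>p\<bar> * N powr p"
      using False assms by (simp add: powr_divide powr_minus field_simps)
    finally show ?thesis .
  qed
qed

text \<open>One of \<open>a\<close>, \<open>b\<close> is at least \<open>N / 2\<close>, and its
  power is comparable to that of \<open>N\<close>. What remains on the right is summable over the
  convolution index from either end when \<open>q < -1\<close>.\<close>

lemma powr_prod_le:
  fixes a b N p q :: real
  assumes "1 \<le> a" "1 \<le> b" "a + b = N + 1" "q < 0"
  shows "a powr p * b powr q \<le> 2 powr (\<bar>p\<bar> + \<bar>q\<bar>) * N powr (max p q) * (a powr q + b powr q)"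
proof (cases "b \<ge> N / 2")
  case True
  have N: "N \<ge> 1" "a \<le> N" "b \<le> N" using assms by linarith+
  have 1: "b powr q \<le> 2 powr \<bar>q\<bar> * N powr q"
    using True N by (intro powr_half_le) auto
  have 2: "a powr p * N powr q \<le> N powr (max p q) * a powr q"
  proof (cases "q \<le> p")
    case True
    have "a powr p * N powr q = a powr (p - q) * (a powr q * N powr q)"
      using assms by (simp add: powr_diff)
    also have "\<dots> \<le> N powr (p - q) * (a powr q * N powr q)"
      using N assms True by (intro mult_right_mono powr_mono2) auto
    also have "\<dots> = N powr (max p q) * a powr q"
      using N True by (simp add: powr_diff max_def)
    finally show ?thesis .
  next
    case False
    hence "a powr p \<le> a powr q" using assms by (intro powr_mono) auto
    thus ?thesis using False by (simp add: max_def mult.commute mult_left_mono)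
  qed
  have "a powr p * b powr q \<le> 2 powr \<bar>q\<bar> * (a powr p * N powr q)"
    using mult_left_mono[OF 1, of "a powr p"] by (simp add: mult_ac)
  also have "\<dots> \<le> 2 powr \<bar>q\<bar> * (N powr (max p q) * a powr q)"
    using 2 by (intro mult_left_mono) auto
  also have "\<dots> \<le> 2 powr (\<bar>p\<bar> + \<bar>q\<bar>) * (N powr (max p q) * (a powr q + b powr q))"
    using N(1) by (intro mult_mono powr_mono) auto
  finally show ?thesis by (simp add: mult.assoc)
next
  case False
  have N: "N \<ge> 1" "a \<le> N" "b \<le> N" "a \<ge> N / 2" using assms(1-3) False by linarith+
  have "a powr p \<le> 2 powr \<bar>p\<bar> * N powr p"
    using N by (intro powr_half_le) auto
  also have "\<dots> \<le> 2 powr (\<bar>p\<bar> + \<bar>q\<bar>) * N powr (max p q)"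
    using N(1) by (intro mult_mono powr_mono) auto
  finally have "a powr p * b powr q \<le> 2 powr (\<bar>p\<bar> + \<bar>q\<bar>) * N powr (max p q) * b powr q"
    by (rule mult_right_mono) auto
  also have "\<dots> \<le> 2 powr (\<bar>p\<bar> + \<bar>q\<bar>) * N powr (max p q) * (a powr q + b powr q)"
    by (intro mult_left_mono) auto
  finally show ?thesis .
qed

text \<open>Convolution with a summable sequence preserves the slower of the two rates: after
  \<open>powr_prod_le\<close> the common factor leaves the sum, and what is left is at most twice
  the convergent series \<open>S\<close>.\<close>

lemma growth_mult:
  assumes "growth p F" "growth q G" "q < -1"
  shows "growth (max p q) (F * G)"
proof -
  obtain C where C: "C \<ge> 0" "\<And>n. norm (F $ n) \<le> C * (1 + real n) powr p"
    using growthE[OF assms(1)] by blast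
  obtain D where D: "D \<ge> 0" "\<And>n. norm (G $ n) \<le> D * (1 + real n) powr q"
    using growthE[OF assms(2)] by blast
  define S where "S = (\<Sum>n. (1 + real n) powr q)"
  have S: "(\<Sum>i\<le>n. (1 + real i) powr q) \<le> S" for n
    unfolding S_def using summable_Suc_powr[OF assms(3)] by (intro sum_le_suminf) auto
  define K where "K = C * D * 2 powr (\<bar>p\<bar> + \<bar>q\<bar>)"
  have K: "K \<ge> 0" using C D by (simp add: K_def)
  show ?thesis
  proof (rule growthI)
    fix n
    have "norm ((F * G) $ n) \<le> (\<Sum>i\<le>n. norm (F $ i) * norm (G $ (n - i)))"
      unfolding fps_mult_nth atLeast0AtMost
      by (rule order_trans[OF norm_sum]) (simp add: norm_mult)
    also have "\<dots> \<le> (\<Sum>i\<le>n. K * (1 + real n) powr (max p q) *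
                  ((1 + real i) powr q + (1 + real (n - i)) powr q))"
    proof (rule sum_mono)
      fix i assume i: "i \<in> {..n}"
      have "norm (F $ i) * norm (G $ (n - i)) \<le>
              (C * (1 + real i) powr p) * (D * (1 + real (n - i)) powr q)"
        by (intro mult_mono C D) (use C(1) in auto)
      also have "\<dots> = C * D * ((1 + real i) powr p * (1 + real (n - i)) powr q)" by simp
      \<comment> \<open>Taken with a = 1 + i, b = 1 + (n - i) and N = 1 + n, so that a + b = N +
        1.\<close>
      also have "\<dots> \<le> C * D * (2 powr (\<bar>p\<bar> + \<bar>q\<bar>) * (1 + real n) powr (max p q) *
                  ((1 + real i) powr q + (1 + real (n - i)) powr q))"
        by (intro mult_left_mono powr_prod_le) (use i assms(3) C D in \<open>auto simp: of_nat_diff\<close>)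
      finally show "norm (F $ i) * norm (G $ (n - i)) \<le> K * (1 + real n) powr (max p q) *
                  ((1 + real i) powr q + (1 + real (n - i)) powr q)"
        by (simp add: K_def mult_ac)
    qed
    also have "\<dots> = K * (1 + real n) powr (max p q) *
        ((\<Sum>i\<le>n. (1 + real i) powr q) + (\<Sum>i\<le>n. (1 + real (n - i)) powr q))"
      by (simp only: sum.distrib flip: sum_distrib_left)
    also have "(\<Sum>i\<le>n. (1 + real (n - i)) powr q) = (\<Sum>i\<le>n. (1 + real i) powr q)"
      by (rule sum.reindex_bij_witness[of _ "\<lambda>i. n - i" "\<lambda>i. n - i"]) auto
    also have "K * (1 + real n) powr (max p q) *
        ((\<Sum>i\<le>n. (1 + real i) powr q) + (\<Sum>i\<le>n. (1 + real i) powr q)) \<le>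
       K * (1 + real n) powr (max p q) * (S + S)"
      using S[of n] K by (intro mult_left_mono add_mono) auto
    finally show "norm ((F * G) $ n) \<le> (2 * K * S) * (1 + real n) powr (max p q)"
      by (simp add: mult_ac)
  qed
qed

section \<open>Binomial and power series\<close>

lemma norm_of_nat_powr: "norm (of_nat n powr z :: complex) = real n powr Re z"
  using norm_powr_real_powr[of "of_nat n" z] by simp

text \<open>The expansion of (1 + c X) powr a, with \<open>c\<close> kept separate so that all three
  factors of the weights are instances.\<close>

definition binom_fps :: "complex \<Rightarrow> complex \<Rightarrow> complex fps" where
  "binom_fps c a = Abs_fps (\<lambda>n. c ^ n * (a gchoose n))"

lemma binom_fps_nth: "binom_fps c a $ n = c ^ n * (a gchoose n)"
  by (simp add: binom_fps_def)

lemma binom_fps_add: "binom_fps c (a + b) = binom_fps c a * binom_fps c b"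
proof (rule fps_ext)
  fix n
  have "(a + b gchoose n) = (\<Sum>i=0..n. (a gchoose i) * (b gchoose (n - i)))"
    using arg_cong[OF fps_binomial_add_mult[of a b], of "\<lambda>F. F $ n"]
    by (simp add: fps_mult_nth)
  moreover have "c ^ n = c ^ i * c ^ (n - i)" if "i \<le> n" for i
    using that by (simp flip: power_add)
  ultimately show "binom_fps c (a + b) $ n = (binom_fps c a * binom_fps c b) $ n"
    by (simp add: binom_fps_nth fps_mult_nth sum_distrib_left mult_ac)
qed

lemma binom_fps_0: "binom_fps c 0 = 1"
  by (rule fps_ext) (simp add: binom_fps_nth gbinomial_0_left)

lemma binom_fps_1: "binom_fps c 1 = 1 + fps_const c * fps_X"
proof (rule fps_ext)
  fix n
  have "(1 :: complex) gchoose n = of_nat (1 choose n)"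
    by (simp add: binomial_gbinomial)
  thus "binom_fps c 1 $ n = (1 + fps_const c * fps_X) $ n"
    by (cases "n \<le> 1") (auto simp: binom_fps_nth le_Suc_eq)
qed

text \<open>The expansion of \<open>(1 - X) powr (-\<mu>)\<close>.\<close>

definition npow_fps :: "complex \<Rightarrow> complex fps" where
  "npow_fps \<mu> = Abs_fps (\<lambda>n. pochhammer \<mu> n / fact n)"

lemma npow_fps_nth: "npow_fps \<mu> $ n = pochhammer \<mu> n / fact n"
  by (simp add: npow_fps_def)

lemma npow_fps_eq_binom: "npow_fps \<mu> = binom_fps (-1) (-\<mu>)"
  by (rule fps_ext) (simp add: npow_fps_nth binom_fps_nth gbinomial_pochhammer flip: power_mult_distrib)

lemma npow_fps_add: "npow_fps (a + b) = npow_fps a * npow_fps b"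
  by (simp add: npow_fps_eq_binom flip: binom_fps_add)

lemma npow_fps_0: "npow_fps 0 = 1"
  by (simp add: npow_fps_eq_binom binom_fps_0)

lemma npow_fps_minus_1: "npow_fps (-1) = 1 - fps_X"
  by (simp add: npow_fps_eq_binom binom_fps_1 flip: fps_const_neg)

lemma npow_fps_diff_1: "npow_fps (a - 1) = npow_fps a * (1 - fps_X)"
  using npow_fps_add[of a "-1"] by (simp add: npow_fps_minus_1)

text \<open>Coefficient form of the differential equation (1 - X) F' = \<mu> F.\<close>

lemma npow_fps_Suc:
  "of_nat (Suc n) * npow_fps \<mu> $ Suc n = (\<mu> + of_nat n) * npow_fps \<mu> $ n"
  by (simp add: npow_fps_nth pochhammer_rec' field_simps del: of_nat_Suc)

text \<open>Euler's limit for 1/\<Gamma>. The library series has one Pochhammer factor more, which n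
  / (\<mu> + n) removes in the limit. At the poles of \<Gamma> the limit is 0, so no case is
  excluded.\<close>

lemma tendsto_npow_fps:
  "(\<lambda>n. npow_fps \<mu> $ n / of_nat n powr (\<mu> - 1)) \<longlonglongrightarrow> rGamma \<mu>"
proof -
  have "(\<lambda>n. of_nat n / (\<mu> + of_nat n)) \<longlonglongrightarrow> 1"
  proof (rule Lim_transform_eventually)
    show "(\<lambda>n. 1 / (\<mu> / of_nat n + 1)) \<longlonglongrightarrow> 1"
      using tendsto_divide[OF tendsto_const[of 1] tendsto_add[OF lim_const_over_n[of \<mu>] tendsto_const[of 1]]]
      by simp
    show "eventually (\<lambda>n. 1 / (\<mu> / of_nat n + 1) = of_nat n / (\<mu> + of_nat n)) sequentially"
      using eventually_gt_at_top[of 0]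
    proof eventually_elim
      case (elim n)
      hence "\<mu> / of_nat n + 1 = (\<mu> + of_nat n) / of_nat n" by (simp add: field_simps)
      thus ?case by simp
    qed
  qed
  from tendsto_mult[OF rGamma_series_LIMSEQ[of \<mu>] this]
  have "(\<lambda>n. rGamma_series \<mu> n * (of_nat n / (\<mu> + of_nat n))) \<longlonglongrightarrow> rGamma \<mu>"
    by simp
  moreover have "eventually (\<lambda>n. rGamma_series \<mu> n * (of_nat n / (\<mu> + of_nat n)) =
      npow_fps \<mu> $ n / of_nat n powr (\<mu> - 1)) sequentially"
    \<comment> \<open>Beyond the norm of \<mu> the factor \<mu> + n cannot vanish and may be
      cancelled.\<close>
    using eventually_gt_at_top[of "nat \<lceil>norm \<mu>\<rceil>"]
  proof eventually_elim
    case (elim n)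
    hence n: "n > 0" "norm \<mu> < real n" by linarith+
    hence nz: "\<mu> + of_nat n \<noteq> 0"
      by (metis add_eq_0_iff less_irrefl norm_minus_cancel norm_of_nat)
    have "exp (\<mu> * of_real (ln (of_nat n))) = of_nat n powr \<mu>"
      using n by (simp add: powr_def Ln_of_nat)
    hence "rGamma_series \<mu> n = pochhammer \<mu> n * (\<mu> + of_nat n) / (fact n * of_nat n powr \<mu>)"
      by (simp add: rGamma_series_def pochhammer_rec' mult.commute)
    hence "rGamma_series \<mu> n * (of_nat n / (\<mu> + of_nat n)) =
        pochhammer \<mu> n / fact n / (of_nat n powr \<mu> / of_nat n)"
      using nz n by (simp only:) (simp add: divide_simps)
    thus ?case using n by (simp add: npow_fps_nth powr_diff)
  qed
  ultimately show ?thesis by (rule Lim_transform_eventually)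
qed

lemma growth_npow_fps: "growth (Re \<mu> - 1) (npow_fps \<mu>)"
proof -
  have "Bseq (\<lambda>n. npow_fps \<mu> $ n / of_nat n powr (\<mu> - 1))"
    using tendsto_npow_fps by (intro convergent_imp_Bseq) (auto simp: convergent_def)
  then obtain C where C: "C > 0" "\<And>n. norm (npow_fps \<mu> $ n / of_nat n powr (\<mu> - 1)) \<le> C"
    by (auto elim: BseqE)
  show ?thesis
  proof (rule growth_eventually)
    fix n :: nat assume n: "n \<ge> 1"
    have "real n powr (Re \<mu> - 1) \<le> 2 powr \<bar>Re \<mu> - 1\<bar> * (1 + real n) powr (Re \<mu> - 1)"
      using n by (intro powr_half_le) auto
    moreover have "norm (npow_fps \<mu> $ n) \<le> C * real n powr (Re \<mu> - 1)"
      using C(2)[of n] n by (simp add: norm_divide norm_of_nat_powr divide_simps)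
    ultimately show "norm (npow_fps \<mu> $ n) \<le>
         C * 2 powr \<bar>Re \<mu> - 1\<bar> * (1 + real n) powr (Re \<mu> - 1)"
      using C(1) by (smt (verit) mult.assoc mult_left_mono)
  qed
qed

text \<open>The coefficient at index 0 is 0 for every \<beta>, also for \<beta> = 0. The convention
  that 0 to the power 0 is 1 is restored later by adding a constant series.\<close>

definition power_fps :: "complex \<Rightarrow> complex fps" where
  "power_fps \<beta> = Abs_fps (\<lambda>n. of_nat n powr \<beta>)"

lemma power_fps_nth: "power_fps \<beta> $ n = of_nat n powr \<beta>"
  by (simp add: power_fps_def)

text \<open>The weight \<open>1 + real n\<close> keeps \<open>growth\<close> meaningful at index 0,
  where \<open>real n powr p\<close> is 0. From index 1 on the two weights differ by a bounded
  factor; \<open>growth_leD\<close> goes back.\<close>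

lemma growth_of_nat_powr:
  assumes "\<And>n. n \<ge> N \<Longrightarrow> norm (F $ n) \<le> C * real n powr p"
  shows "growth p F"
proof (rule growth_eventually)
  fix n :: nat assume n: "n \<ge> N + 1"
  have "real n powr p \<le> 2 powr \<bar>p\<bar> * (1 + real n) powr p"
    using n by (intro powr_half_le) auto
  hence "\<bar>C\<bar> * real n powr p \<le> \<bar>C\<bar> * (2 powr \<bar>p\<bar> * (1 + real n) powr p)"
    by (intro mult_left_mono) auto
  moreover have "C * real n powr p \<le> \<bar>C\<bar> * real n powr p"
    by (intro mult_right_mono) auto
  moreover have "norm (F $ n) \<le> C * real n powr p" using assms n by simp
  ultimately show "norm (F $ n) \<le> \<bar>C\<bar> * 2 powr \<bar>p\<bar> * (1 + real n) powr p"
    by (simp only: mult.assoc)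
qed

lemma growth_power_fps: "growth (Re \<beta>) (power_fps \<beta>)"
  by (rule growth_of_nat_powr[where N = 1 and C = 1])
     (simp add: power_fps_nth norm_of_nat_powr)

lemma growth_leD:
  assumes "growth p F"
  obtains C where "C \<ge> 0" "\<And>n. n \<ge> 1 \<Longrightarrow> norm (F $ n) \<le> C * real n powr p"
proof -
  obtain C where C: "C \<ge> 0" "\<And>n. norm (F $ n) \<le> C * (1 + real n) powr p"
    using growthE[OF assms] by blast
  have "norm (F $ n) \<le> C * 2 powr \<bar>p\<bar> * real n powr p" if n: "n \<ge> 1" for n
  proof -
    have "(1 + real n) powr p = (1 / (1 + real n)) powr (-p)"
      by (simp add: powr_divide powr_minus)
    also have "\<dots> \<le> 2 powr \<bar>-p\<bar> * (1 / real n) powr (-p)"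
      using n by (intro powr_half_le) (auto simp: field_simps)
    also have "\<dots> = 2 powr \<bar>p\<bar> * real n powr p"
      using n by (simp add: powr_divide powr_minus)
    finally have "C * (1 + real n) powr p \<le> C * (2 powr \<bar>p\<bar> * real n powr p)"
      using C(1) by (intro mult_left_mono)
    thus ?thesis using C(2)[of n] by simp
  qed
  thus ?thesis using that[of "C * 2 powr \<bar>p\<bar>"] C(1) by simp
qed

lemma growth_tendsto_0:
  assumes "growth p F" "p < Re \<beta>"
  shows "(\<lambda>n. F $ n / of_nat n powr \<beta>) \<longlonglongrightarrow> 0"
proof -
  obtain C where C: "C \<ge> 0" "\<And>n. n \<ge> 1 \<Longrightarrow> norm (F $ n) \<le> C * real n powr p"
    using growth_leD[OF assms(1)] by blast
  have "((\<lambda>x. x powr (p - Re \<beta>)) \<longlongrightarrow> 0) at_top"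
    using tendsto_neg_powr[of "p - Re \<beta>" "\<lambda>x. x" at_top] assms(2) by (simp add: filterlim_ident)
  hence "(\<lambda>n. C * real n powr (p - Re \<beta>)) \<longlonglongrightarrow> C * 0"
    by (intro tendsto_mult tendsto_const) (rule filterlim_compose[OF _ filterlim_real_sequentially])
  moreover have "eventually (\<lambda>n. norm (F $ n / of_nat n powr \<beta>) \<le> C * real n powr (p - Re \<beta>)) sequentially"
    using eventually_ge_at_top[of 1]
  proof eventually_elim
    case (elim n)
    thus ?case using C(2)[of n] by (simp add: norm_divide norm_of_nat_powr powr_diff divide_simps)
  qed
  ultimately show ?thesis using Lim_null_comparison by force
qed

section \<open>Asymptotic expansion of the power sequence\<close>

lemma gchoose_half_summable:
  fixes \<gamma> :: complex
  shows "summable (\<lambda>j. norm (\<gamma> gchoose (j + N)) * (1/2) ^ j)"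
proof -
  have "summable (\<lambda>n. norm ((\<gamma> gchoose n) * (1/2) ^ n))"
    \<comment> \<open>Convergence at 3/4 gives absolute convergence at 1/2; any point strictly
      between 1/2 and 1 would serve.\<close>
    by (rule powser_insidea[of _ "3/4"])
       (use gen_binomial_complex[of "3/4" \<gamma>] in \<open>auto simp: sums_iff norm_divide\<close>)
  hence "summable (\<lambda>j. norm ((\<gamma> gchoose (j + N)) * (1/2) ^ (j + N)))"
    by (subst summable_iff_shift)
  hence "summable (\<lambda>j. 2 ^ N * norm ((\<gamma> gchoose (j + N)) * (1/2) ^ (j + N)))"
    by (rule summable_mult)
  also have "(\<lambda>j. 2 ^ N * norm ((\<gamma> gchoose (j + N)) * (1/2) ^ (j + N))) =
      (\<lambda>j. norm (\<gamma> gchoose (j + N)) * (1/2) ^ j)"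
    by (rule ext) (simp add: norm_mult norm_power norm_divide power_add power_one_over)
  finally show ?thesis .
qed

text \<open>The binomial series of (1 + 1/n) powr \<gamma>, multiplied by n powr \<gamma> and cut
  after \<open>N\<close> terms.\<close>

lemma power_Suc_expansion:
  "growth (Re \<gamma> - real N)
     (Abs_fps (\<lambda>n. of_nat (Suc n) powr \<gamma>) - (\<Sum>k<N. fps_const (\<gamma> gchoose k) * power_fps (\<gamma> - of_nat k)))"
    (is "growth _ ?F")
proof (rule growth_of_nat_powr)
  define B where "B = (\<Sum>j. norm (\<gamma> gchoose (j + N)) * (1/2) ^ j)"
  \<comment> \<open>From n = 2 on, 1/n is at most 1/2, so the single series \<open>B\<close>
    dominates every tail once n powr (Re \<gamma> - N) has been taken out.\<close>
  fix n :: nat assume n: "n \<ge> 2"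
  define t where "t = (\<lambda>k. (\<gamma> gchoose k) * of_nat n powr (\<gamma> - of_nat k))"
  have "(\<lambda>k. (\<gamma> gchoose k) * of_real (real n) powr (\<gamma> - of_nat k) * of_real 1 ^ k) sums
          of_real (real n + 1) powr \<gamma>"
    by (rule gen_binomial_complex'') (use n in auto)
  hence "t sums of_nat (Suc n) powr \<gamma>" by (simp add: t_def add.commute)
  hence "(\<lambda>j. t (j + N)) sums (of_nat (Suc n) powr \<gamma> - (\<Sum>k<N. t k))"
    by (rule sums_split_initial_segment)
  hence eq: "?F $ n = (\<Sum>j. t (j + N))"
    by (simp add: fps_sum_nth power_fps_nth t_def sums_iff)
  have bound: "norm (t (j + N)) \<le> (norm (\<gamma> gchoose (j + N)) * (1/2) ^ j) * real n powr (Re \<gamma> - real N)" for j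
  proof -
    have "real n powr (Re \<gamma> - real (j + N)) = real n powr (Re \<gamma> - real N) * (1 / real n) ^ j"
      using n by (simp add: powr_diff powr_add power_divide powr_realpow)
    also have "\<dots> \<le> real n powr (Re \<gamma> - real N) * (1/2) ^ j"
      using n by (intro mult_left_mono power_mono) (auto simp: field_simps)
    finally have "norm (\<gamma> gchoose (j + N)) * real n powr (Re \<gamma> - real (j + N)) \<le>
        norm (\<gamma> gchoose (j + N)) * (real n powr (Re \<gamma> - real N) * (1/2) ^ j)"
      by (intro mult_left_mono) auto
    thus ?thesis by (simp add: t_def norm_mult norm_of_nat_powr mult_ac)
  qed
  have "norm (\<Sum>j. t (j + N)) \<le>
      (\<Sum>j. (norm (\<gamma> gchoose (j + N)) * (1/2) ^ j) * real n powr (Re \<gamma> - real N))"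
    by (intro norm_suminf_le bound summable_mult2 gchoose_half_summable)
  also have "\<dots> = B * real n powr (Re \<gamma> - real N)"
    unfolding B_def by (intro suminf_mult2[symmetric] gchoose_half_summable)
  finally show "norm (?F $ n) \<le> B * real n powr (Re \<gamma> - real N)" by (simp only: eq)
qed

text \<open>The operator \<open>(1 - X) d/dX - \<mu>\<close> annihilates \<open>(1 - X) powr (-\<mu>)\<close>. For \<open>\<mu> = \<beta> + 1\<close>
  it lowers the order of \<open>n powr \<beta>\<close> from \<open>\<beta>\<close> to \<open>\<beta> - 1\<close>, which drives the induction for
  \<open>power_fps_expansion\<close>; it is inverted by telescoping in \<open>growth_of_euler_op\<close>.\<close>

definition euler_op :: "complex \<Rightarrow> complex fps \<Rightarrow> complex fps" where
  "euler_op \<mu> F = (1 - fps_X) * fps_deriv F - fps_const \<mu> * F"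

lemma euler_op_nth:
  "euler_op \<mu> F $ n = of_nat (Suc n) * F $ Suc n - (of_nat n + \<mu>) * F $ n"
  by (cases n) (auto simp: euler_op_def algebra_simps)

lemma euler_op_add: "euler_op \<mu> (F + G) = euler_op \<mu> F + euler_op \<mu> G"
  by (simp add: euler_op_def algebra_simps)

lemma euler_op_cmult: "euler_op \<mu> (fps_const c * F) = fps_const c * euler_op \<mu> F"
  by (simp add: euler_op_def algebra_simps)

lemma euler_op_sum: "euler_op \<mu> (\<Sum>i\<in>I. F i) = (\<Sum>i\<in>I. euler_op \<mu> (F i))"
  by (simp add: euler_op_def sum_distrib_left sum_subtractf fps_deriv_sum)

lemma euler_op_npow: "euler_op \<mu> (npow_fps \<nu>) = fps_const (\<nu> - \<mu>) * npow_fps \<nu>"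
  by (rule fps_ext) (simp add: euler_op_nth npow_fps_Suc algebra_simps del: of_nat_Suc)

text \<open>Gives an explicit tail bound for the sum of 1 / x^(K+1) over unit steps. It follows from
  (x/(x+1))^K \<le> x/(x+1) and x + 1 \<le> 2 x.\<close>

lemma inverse_power_telescope:
  fixes x :: real
  assumes "x \<ge> 1" "K \<ge> 1"
  shows "1 / x ^ Suc K \<le> 2 * (1 / x ^ K - 1 / (x + 1) ^ K)"
proof -
  have "(x / (x + 1)) ^ K \<le> (x / (x + 1)) ^ 1"
    using assms by (intro power_decreasing) auto
  also have "(x / (x + 1)) ^ 1 = 1 - 1 / (x + 1)"
    using assms by (simp add: field_simps)
  finally have "1 / (x + 1) \<le> 1 - (x / (x + 1)) ^ K" by simp
  moreover have "1 / (2 * x) \<le> 1 / (x + 1)"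
    using assms by (intro divide_left_mono) auto
  ultimately have "1 / (2 * x) \<le> 1 - (x / (x + 1)) ^ K" by linarith
  hence "2 / x ^ K * (1 / (2 * x)) \<le> 2 / x ^ K * (1 - (x / (x + 1)) ^ K)"
    using assms by (intro mult_left_mono) auto
  also have "\<dots> = 2 * (1 / x ^ K - 1 / (x + 1) ^ K)"
    using assms by (simp add: power_divide right_diff_distrib)
  finally show ?thesis using assms by (simp add: mult.commute)
qed

text \<open>Variation of constants. Divided by the homogeneous solution \<open>a\<close>, the
  sequence \<open>w\<close> becomes \<open>q\<close>, whose increments are the inhomogeneity over
  (n+1) a(n+1), hence of order n powr (-K - 1). So \<open>q\<close> reaches its limit L
  \<Gamma>(\<beta>+1) at rate n powr (-K), and multiplying back by \<open>a\<close> gives the claim.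
  The condition on \<beta> keeps \<open>a\<close> away from 0.\<close>

lemma growth_of_euler_op:
  assumes \<beta>: "\<beta> + 1 \<notin> \<int>\<^sub>\<le>\<^sub>0" and K: "K \<ge> 1"
    and S: "growth (Re \<beta> - real K) (euler_op (\<beta> + 1) w)"
    and lim: "(\<lambda>n. w $ n / of_nat n powr \<beta>) \<longlonglongrightarrow> L"
  shows "growth (Re \<beta> - real K) (w - fps_const (L * Gamma (\<beta> + 1)) * npow_fps (\<beta> + 1))"
proof -
  define a where "a = (\<lambda>n. npow_fps (\<beta> + 1) $ n)"
  have nz: "\<beta> + 1 + of_nat n \<noteq> 0" for n
  proof
    assume "\<beta> + 1 + of_nat n = 0"
    hence "\<beta> + 1 = - of_nat n" by (simp add: add_eq_0_iff2)
    with \<beta> show False by simp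
  qed
  have a_nz: "a n \<noteq> 0" for n
    using nz by (auto simp: a_def npow_fps_nth pochhammer_eq_0_iff add_eq_0_iff2)
  have a_Suc: "of_nat (Suc n) * a (Suc n) = (of_nat n + (\<beta> + 1)) * a n" for n
    using npow_fps_Suc[of n "\<beta> + 1"] by (simp add: a_def add.commute del: of_nat_Suc)
  have r: "rGamma (\<beta> + 1) \<noteq> 0" using \<beta> by (simp add: rGamma_eq_zero_iff)
  have "(\<lambda>n. inverse (a n / of_nat n powr \<beta>)) \<longlonglongrightarrow> inverse (rGamma (\<beta> + 1))"
    using tendsto_npow_fps[of "\<beta> + 1"] r unfolding a_def by (intro tendsto_inverse) auto
  hence inv: "(\<lambda>n. of_nat n powr \<beta> / a n) \<longlonglongrightarrow> Gamma (\<beta> + 1)"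
    by (simp add: rGamma_inverse_Gamma)
  hence "Bseq (\<lambda>n. of_nat n powr \<beta> / a n)"
    by (intro convergent_imp_Bseq) (auto simp: convergent_def)
  then obtain C where C: "C > 0" "\<And>n. norm (of_nat n powr \<beta> / a n) \<le> C"
    by (auto elim: BseqE)
  obtain D where D: "D \<ge> 0" "\<And>n. norm (euler_op (\<beta> + 1) w $ n) \<le> D * (1 + real n) powr (Re \<beta> - real K)"
    using growthE[OF S] by blast
  define q where "q = (\<lambda>n. w $ n / a n)"
  define M where "M = L * Gamma (\<beta> + 1)"
  have qlim: "q \<longlonglongrightarrow> M"
  proof (rule Lim_transform_eventually)
    show "(\<lambda>n. w $ n / of_nat n powr \<beta> * (of_nat n powr \<beta> / a n)) \<longlonglongrightarrow> M"
      unfolding M_def by (intro tendsto_mult lim inv)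
    show "\<forall>\<^sub>F n in sequentially. w $ n / of_nat n powr \<beta> * (of_nat n powr \<beta> / a n) = q n"
      using eventually_gt_at_top[of 0] by eventually_elim (simp add: q_def)
  qed
  \<comment> \<open>A majorant whose differences dominate the steps of \<open>q\<close>; since it is
    nonnegative, the distance from \<open>q n\<close> to the limit is at most
    \<open>B n\<close>.\<close>
  define B where "B = (\<lambda>n. 2 * C * D / (1 + real n) ^ K)"
  have step: "norm (q (Suc n) - q n) \<le> B n - B (Suc n)" for n
  proof -
    have "q (Suc n) - q n = euler_op (\<beta> + 1) w $ n / (of_nat (Suc n) * a (Suc n))"
    proof -
      have "euler_op (\<beta> + 1) w $ n / (of_nat (Suc n) * a (Suc n)) =
          of_nat (Suc n) * w $ Suc n / (of_nat (Suc n) * a (Suc n)) -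
          (of_nat n + (\<beta> + 1)) * w $ n / ((of_nat n + (\<beta> + 1)) * a n)"
        by (simp only: euler_op_nth diff_divide_distrib a_Suc)
      moreover have "of_nat n + (\<beta> + 1) \<noteq> 0" using nz[of n] by (simp add: add_ac)
      moreover have "of_nat (Suc n) \<noteq> (0::complex)" by (simp del: of_nat_Suc)
      ultimately show ?thesis unfolding q_def by (simp only: mult_divide_mult_cancel_left if_False simp_thms)
    qed
    hence "norm (q (Suc n) - q n) = norm (euler_op (\<beta> + 1) w $ n) / (real (Suc n) * norm (a (Suc n)))"
      by (simp only: norm_divide norm_mult norm_of_nat)
    \<comment> \<open>The bound \<open>C\<close> on n powr \<beta> / a n is read as a lower bound
      for the norm of \<open>a\<close>; at index \<open>Suc n\<close> its base is exactly
      \<open>1 + real n\<close>.\<close>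
    also have "\<dots> \<le> D * (1 + real n) powr (Re \<beta> - real K) / (real (Suc n) * ((1 + real n) powr Re \<beta> / C))"
    proof (intro frac_le mult_left_mono D)
      show "(1 + real n) powr Re \<beta> / C \<le> norm (a (Suc n))"
      proof -
        have "(1 + real n) powr Re \<beta> / norm (a (Suc n)) \<le> C"
          using C(2)[of "Suc n"] unfolding norm_divide norm_of_nat_powr by simp
        thus ?thesis using C(1) a_nz[of "Suc n"] by (simp add: divide_le_eq mult.commute)
      qed
    qed (use C D in auto)
    also have "\<dots> = C * D * (1 / (1 + real n) ^ Suc K)"
    proof -
      have "D * (P / X) / (Y * (P / C)) = C * D * (1 / (Y * X))" if "P > 0" for P X Y :: real
        using that C(1) by (simp add: mult.commute)
      from this[of "(1 + real n) powr Re \<beta>" "(1 + real n) ^ K" "1 + real n"] show ?thesis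
        by (simp add: powr_diff powr_realpow)
    qed
    also have "\<dots> \<le> C * D * (2 * (1 / (1 + real n) ^ K - 1 / (1 + real n + 1) ^ K))"
      using C(1) D(1) K by (intro mult_left_mono inverse_power_telescope) auto
    also have "\<dots> = B n - B (Suc n)"
    proof -
      have "B n = 2 * C * D * (1 / (1 + real n) ^ K)"
           "B (Suc n) = 2 * C * D * (1 / (1 + real n + 1) ^ K)"
        by (simp_all add: B_def add_ac)
      thus ?thesis by (simp only: right_diff_distrib mult_ac)
    qed
    finally show ?thesis .
  qed
  have tele: "norm (q (n + m) - q n) \<le> B n - B (n + m)" for n m
  proof (induction m)
    case (Suc m)
    have "norm (q (n + Suc m) - q n) = norm ((q (Suc (n + m)) - q (n + m)) + (q (n + m) - q n))" by simp
    also have "\<dots> \<le> (B (n + m) - B (Suc (n + m))) + (B n - B (n + m))"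
      by (intro norm_triangle_le add_mono step Suc)
    finally show ?case by simp
  qed auto
  have qM: "norm (M - q n) \<le> B n" for n
  proof (rule LIMSEQ_le_const2)
    show "(\<lambda>m. norm (q (m + n) - q n)) \<longlonglongrightarrow> norm (M - q n)"
      using LIMSEQ_ignore_initial_segment[OF qlim, of n] by (intro tendsto_intros)
    show "\<exists>N. \<forall>m\<ge>N. norm (q (m + n) - q n) \<le> B n"
    proof (intro exI allI impI)
      fix m
      have "B (n + m) \<ge> 0" using C D by (simp add: B_def)
      thus "norm (q (m + n) - q n) \<le> B n" using tele[of n m] by (simp add: add.commute)
    qed
  qed
  obtain E where E: "E \<ge> 0" "\<And>n. norm (a n) \<le> E * (1 + real n) powr Re \<beta>"
    using growthE[OF growth_npow_fps[of "\<beta> + 1"]] unfolding a_def by auto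
  show ?thesis unfolding M_def[symmetric]
  proof (rule growthI)
    fix n
    have "(w - fps_const M * npow_fps (\<beta> + 1)) $ n = a n * (q n - M)"
      using a_nz[of n] by (simp add: q_def a_def[symmetric] right_diff_distrib)
    hence "norm ((w - fps_const M * npow_fps (\<beta> + 1)) $ n) = norm (a n) * norm (M - q n)"
      by (simp add: norm_mult norm_minus_commute)
    also have "\<dots> \<le> (E * (1 + real n) powr Re \<beta>) * B n"
      using E by (intro mult_mono qM) auto
    also have "\<dots> = (E * 2 * C * D) * (1 + real n) powr (Re \<beta> - real K)"
      by (simp add: B_def powr_diff powr_realpow)
    finally show "norm ((w - fps_const M * npow_fps (\<beta> + 1)) $ n) \<le>
        (E * 2 * C * D) * (1 + real n) powr (Re \<beta> - real K)" .
  qed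
qed

text \<open>An expansion in the series of (1 - X) powr (k - \<nu> - 1) with all coefficients hidden
  but the leading one, which must stay visible because it determines the second coefficient in
  \<open>power_fps_expansion\<close>. For \<open>M = 0\<close> the value \<open>c\<close> carries no
  information.\<close>

definition expands :: "nat \<Rightarrow> complex \<Rightarrow> complex fps \<Rightarrow> complex \<Rightarrow> bool" where
  "expands M \<nu> F c \<longleftrightarrow> (\<exists>C. C 0 = c \<and>
     growth (Re \<nu> - real M) (F - (\<Sum>k<M. fps_const (C k) * npow_fps (\<nu> + 1 - of_nat k))))"

lemma expands_growth: "growth (Re \<nu> - real M) F \<Longrightarrow> expands M \<nu> F 0"
  unfolding expands_def by (rule exI[of _ "\<lambda>_. 0"]) simp

lemma expands_add:
  assumes "expands M \<nu> F c" "expands M \<nu> G d"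
  shows "expands M \<nu> (F + G) (c + d)"
proof -
  obtain C where C: "C 0 = c"
      "growth (Re \<nu> - real M) (F - (\<Sum>k<M. fps_const (C k) * npow_fps (\<nu> + 1 - of_nat k)))"
    using assms(1) unfolding expands_def by blast
  obtain D where D: "D 0 = d"
      "growth (Re \<nu> - real M) (G - (\<Sum>k<M. fps_const (D k) * npow_fps (\<nu> + 1 - of_nat k)))"
    using assms(2) unfolding expands_def by blast
  show ?thesis unfolding expands_def
  proof (intro exI[of _ "\<lambda>k. C k + D k"] conjI)
    show "growth (Re \<nu> - real M) (F + G - (\<Sum>k<M. fps_const (C k + D k) * npow_fps (\<nu> + 1 - of_nat k)))"
      using growth_add[OF C(2) D(2)]
      by (simp add: sum.distrib distrib_right algebra_simps flip: fps_const_add)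
  qed (use C D in auto)
qed

lemma expands_cmult:
  assumes "expands M \<nu> F c"
  shows "expands M \<nu> (fps_const b * F) (b * c)"
proof -
  obtain C where C: "C 0 = c"
      "growth (Re \<nu> - real M) (F - (\<Sum>k<M. fps_const (C k) * npow_fps (\<nu> + 1 - of_nat k)))"
    using assms(1) unfolding expands_def by blast
  show ?thesis unfolding expands_def
  proof (intro exI[of _ "\<lambda>k. b * C k"] conjI)
    show "growth (Re \<nu> - real M) (fps_const b * F - (\<Sum>k<M. fps_const (b * C k) * npow_fps (\<nu> + 1 - of_nat k)))"
      using growth_cmult[OF C(2), of b]
      by (simp add: right_diff_distrib sum_distrib_left mult.assoc flip: fps_const_mult)
  qed (use C in auto)
qed

lemma expands_sum:
  assumes "finite I" "\<And>i. i \<in> I \<Longrightarrow> expands M \<nu> (F i) (c i)"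
  shows "expands M \<nu> (\<Sum>i\<in>I. F i) (\<Sum>i\<in>I. c i)"
  using assms by (induction I rule: finite_induct) (auto intro: expands_add expands_growth growth_0)

text \<open>Lowering the exponent and the number of terms by the same \<open>m\<close> leaves the
  error order unchanged; seen from \<nu>, the first \<open>m\<close> coefficients are 0.\<close>

lemma expands_shift:
  assumes "expands (M - m) (\<nu> - of_nat m) F c" "m \<le> M"
  shows "expands M \<nu> F (if m = 0 then c else 0)"
proof -
  obtain C where C: "C 0 = c"
      "growth (Re (\<nu> - of_nat m) - real (M - m))
         (F - (\<Sum>k<M-m. fps_const (C k) * npow_fps (\<nu> - of_nat m + 1 - of_nat k)))"
    using assms(1) unfolding expands_def by blast
  let ?D = "\<lambda>k. if k < m then 0 else C (k - m)"
  have "(\<Sum>k<M. fps_const (?D k) * npow_fps (\<nu> + 1 - of_nat k)) =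
        (\<Sum>k\<in>{m..<M}. fps_const (?D k) * npow_fps (\<nu> + 1 - of_nat k))"
    by (rule sum.mono_neutral_right) auto
  also have "\<dots> = (\<Sum>k<M-m. fps_const (C k) * npow_fps (\<nu> - of_nat m + 1 - of_nat k))"
    by (rule sum.reindex_bij_witness[of _ "\<lambda>k. k + m" "\<lambda>k. k - m"])
       (use assms(2) in \<open>auto simp: of_nat_diff algebra_simps\<close>)
  finally show ?thesis unfolding expands_def
    by (intro exI[of _ ?D]) (use C assms(2) in \<open>simp add: of_nat_diff\<close>)
qed

lemma expands_0_irrelevant: "expands 0 \<nu> F c \<Longrightarrow> expands 0 \<nu> F d"
  unfolding expands_def by auto

text \<open>A forbidden exponent can be reached only if \<beta> is a natural number, and then the
  binomial expansion of (n+1) powr (\<beta>+1) has stopped before it.\<close>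

lemma nonpos_Ints_shift_cases:
  fixes \<beta> :: complex
  assumes "\<beta> + 1 \<notin> \<int>\<^sub>\<le>\<^sub>0"
  shows "(\<beta> + 1 gchoose (m + 2)) = 0 \<or> \<beta> - 1 - of_nat m + 1 \<notin> \<int>\<^sub>\<le>\<^sub>0"
proof (rule disjCI)
  assume "\<not> \<beta> - 1 - of_nat m + 1 \<notin> \<int>\<^sub>\<le>\<^sub>0"
  then obtain j where "\<beta> - 1 - of_nat m + 1 = - of_nat j"
    by (auto elim: nonpos_Ints_cases')
  hence b: "\<beta> = of_nat m - of_nat j" by (simp add: algebra_simps)
  have "j \<le> m"
  proof (rule ccontr)
    assume "\<not> j \<le> m"
    hence "\<beta> + 1 = - of_nat (j - m - 1)" using b by (simp add: of_nat_diff)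
    thus False using assms by simp
  qed
  hence "\<beta> + 1 = of_nat (m - j + 1)" using b by (simp add: of_nat_diff)
  hence "(\<beta> + 1 gchoose (m + 2)) = of_nat ((m - j + 1) choose (m + 2))"
    by (simp only: binomial_gbinomial)
  also have "(m - j + 1) choose (m + 2) = 0" by (rule binomial_eq_0) simp
  finally show "(\<beta> + 1 gchoose (m + 2)) = 0" by simp
qed

text \<open>The operator yields (n+1) powr (\<beta>+1) minus n powr (\<beta>+1) minus (\<beta>+1) n
  powr \<beta>. The subtracted terms are the first two of the binomial expansion, so the sum starts
  with the third.\<close>

lemma euler_op_power_fps:
  "growth (Re \<beta> - real (Suc M)) (euler_op (\<beta> + 1) (power_fps \<beta>) -
     (\<Sum>m<M. fps_const (\<beta> + 1 gchoose (m + 2)) * power_fps (\<beta> - 1 - of_nat m)))"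
proof -
  let ?X = "\<Sum>m<M. fps_const (\<beta> + 1 gchoose (m + 2)) * power_fps (\<beta> - 1 - of_nat m)"
  have 1: "euler_op (\<beta> + 1) (power_fps \<beta>) =
      Abs_fps (\<lambda>n. of_nat (Suc n) powr (\<beta> + 1)) - power_fps (\<beta> + 1) - fps_const (\<beta> + 1) * power_fps \<beta>"
  proof (rule fps_ext)
    fix n
    show "euler_op (\<beta> + 1) (power_fps \<beta>) $ n = (Abs_fps (\<lambda>n. of_nat (Suc n) powr (\<beta> + 1)) -
        power_fps (\<beta> + 1) - fps_const (\<beta> + 1) * power_fps \<beta>) $ n"
      by (cases "n = 0") (simp_all add: euler_op_nth power_fps_nth powr_add algebra_simps del: of_nat_Suc)
  qed
  have 2: "(\<Sum>k<M+2. fps_const (\<beta> + 1 gchoose k) * power_fps (\<beta> + 1 - of_nat k)) =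
      power_fps (\<beta> + 1) + fps_const (\<beta> + 1) * power_fps \<beta> +
      (\<Sum>m<M. fps_const (\<beta> + 1 gchoose (m + 2)) * power_fps (\<beta> - 1 - of_nat m))"
    by (simp add: sum.lessThan_Suc_shift algebra_simps del: sum.lessThan_Suc)
  have "Re (\<beta> + 1) - real (M + 2) = Re \<beta> - real (Suc M)" by simp
  with power_Suc_expansion[of "\<beta> + 1" "M + 2"] show ?thesis
    by (simp only: 1 2 diff_diff_eq)
qed

text \<open>At \<open>\<beta> = 0\<close> the library value \<open>Gamma 0 = 0\<close> makes \<open>c 1 = 0\<close>, which is right since
  \<open>npow_fps 1\<close> is then exactly the constant sequence.\<close>

lemma power_fps_expansion:
  assumes "\<beta> + 1 \<notin> \<int>\<^sub>\<le>\<^sub>0"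
  shows "\<exists>c. c 0 = Gamma (\<beta> + 1) \<and> c (Suc 0) = - ((\<beta> + 1 gchoose 2) * Gamma \<beta>) \<and>
           growth (Re \<beta> - real K)
             (power_fps \<beta> - (\<Sum>i<K. fps_const (c i) * npow_fps (\<beta> + 1 - of_nat i)))"
  using assms
\<comment> \<open>The operator produces the exponents \<beta> - 1 - m, each needed only to K - 1 - m
  terms; so the hypothesis is applied at other \<beta> and various smaller K.\<close>
proof (induction K arbitrary: \<beta> rule: less_induct)
  case (less K)
  show ?case
  proof (cases K)
    case 0
    thus ?thesis using growth_power_fps[of \<beta>]
      by (intro exI[of _ "\<lambda>i. if i = 0 then Gamma (\<beta> + 1) else - ((\<beta> + 1 gchoose 2) * Gamma \<beta>)"]) auto
  next
    case (Suc M)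
    let ?b = "\<lambda>m::nat. \<beta> + 1 gchoose (m + 2)"
    \<comment> \<open>Only the term m = 0 reaches the exponent \<beta> - 1, so it alone feeds the
      leading coefficient.\<close>
    let ?c = "\<lambda>m::nat. if m = 0 then ?b 0 * Gamma \<beta> else 0"
    let ?S = "euler_op (\<beta> + 1) (power_fps \<beta>)"
    have summand: "expands M (\<beta> - 1) (fps_const (?b m) * power_fps (\<beta> - 1 - of_nat m)) (?c m)"
      if m: "m < M" for m
    proof (cases "?b m = 0")
      case True
      moreover from this have "?c m = 0" by auto
      ultimately show ?thesis by (auto intro: expands_growth growth_0)
    next
      case False
      hence *: "\<beta> - 1 - of_nat m + 1 \<notin> \<int>\<^sub>\<le>\<^sub>0" using nonpos_Ints_shift_cases[OF less.prems] by blast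
      have "M - m < K" using Suc by simp
      from less.IH[OF this *] obtain c where
        "c 0 = Gamma (\<beta> - 1 - of_nat m + 1)"
        "growth (Re (\<beta> - 1 - of_nat m) - real (M - m)) (power_fps (\<beta> - 1 - of_nat m) -
           (\<Sum>i<M - m. fps_const (c i) * npow_fps (\<beta> - 1 - of_nat m + 1 - of_nat i)))"
        by blast
      hence "expands (M - m) (\<beta> - 1 - of_nat m) (power_fps (\<beta> - 1 - of_nat m)) (Gamma (\<beta> - 1 - of_nat m + 1))"
        unfolding expands_def by blast
      from expands_cmult[OF expands_shift[OF this], of "?b m"]
      show ?thesis using m by (auto cong: if_cong split: if_splits)
    qed
    have "expands M (\<beta> - 1)
        (?S - (\<Sum>m<M. fps_const (?b m) * power_fps (\<beta> - 1 - of_nat m)) +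
        (\<Sum>m<M. fps_const (?b m) * power_fps (\<beta> - 1 - of_nat m))) (0 + (\<Sum>m<M. ?c m))"
      using euler_op_power_fps[of \<beta> M]
      by (intro expands_add expands_sum expands_growth summand) (simp_all add: algebra_simps)
    hence "expands M (\<beta> - 1) ?S (\<Sum>m<M. ?c m)" by simp
    hence "expands M (\<beta> - 1) ?S (?b 0 * Gamma \<beta>)"
    \<comment> \<open>For M = 0 the sum of leading coefficients is empty, but an expansion without
      terms may claim any leading coefficient.\<close>
    proof (cases "M = 0")
      case False
      have "(\<Sum>m<M. ?c m) = (\<Sum>m\<in>{0}. ?c m)"
        by (rule sum.mono_neutral_right) (use False in auto)
      thus ?thesis using \<open>expands M (\<beta> - 1) ?S (\<Sum>m<M. ?c m)\<close> by simp
    qed (auto intro: expands_0_irrelevant)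
    then obtain C where C: "C 0 = ?b 0 * Gamma \<beta>"
        "growth (Re \<beta> - real K) (?S - (\<Sum>k<M. fps_const (C k) * npow_fps (\<beta> - of_nat k)))"
      unfolding expands_def by (auto simp: Suc algebra_simps)
    \<comment> \<open>The operator multiplies \<open>npow_fps (\<beta> - of_nat k)\<close> by
      -(k+1); dividing \<open>C k\<close> by k+1 therefore removes exactly the expanded part of
      \<open>?S\<close>.\<close>
    define w where "w = power_fps \<beta> + (\<Sum>k<M. fps_const (C k / of_nat (Suc k)) * npow_fps (\<beta> - of_nat k))"
    have "euler_op (\<beta> + 1) w = ?S - (\<Sum>k<M. fps_const (C k) * npow_fps (\<beta> - of_nat k))"
    proof -
      have "euler_op (\<beta> + 1) (fps_const (C k / of_nat (Suc k)) * npow_fps (\<beta> - of_nat k)) =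
            - (fps_const (C k) * npow_fps (\<beta> - of_nat k))" for k
      proof -
        have "\<beta> - of_nat k - (\<beta> + 1) = - of_nat (Suc k)" by simp
        thus ?thesis
          by (simp only: euler_op_cmult euler_op_npow mult.assoc[symmetric] fps_const_mult)
             (simp del: of_nat_Suc flip: fps_const_neg)
      qed
      thus ?thesis by (simp add: w_def euler_op_add euler_op_sum sum_negf)
    qed
    with C(2) have S: "growth (Re \<beta> - real K) (euler_op (\<beta> + 1) w)" by simp
    \<comment> \<open>The corrections are of lower order, so \<open>w\<close> is still asymptotic to
      n powr \<beta>. The limit 1 fixes the leading coefficient as \<Gamma>(\<beta>+1).\<close>
    have "growth (Re \<beta> - 1) (w - power_fps \<beta>)"
      unfolding w_def add_diff_cancel_left'
    proof (intro growth_sum growth_cmult)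
      fix k
      show "growth (Re \<beta> - 1) (npow_fps (\<beta> - of_nat k))"
        by (rule growth_mono[OF growth_npow_fps]) simp
    qed
    from growth_tendsto_0[OF this, of \<beta>]
    have "(\<lambda>n. (w - power_fps \<beta>) $ n / of_nat n powr \<beta> + 1) \<longlonglongrightarrow> 0 + 1"
      by (intro tendsto_add) auto
    moreover have "\<forall>\<^sub>F n in sequentially. (w - power_fps \<beta>) $ n / of_nat n powr \<beta> + 1 = w $ n / of_nat n powr \<beta>"
      using eventually_gt_at_top[of 0]
      by eventually_elim (simp add: power_fps_nth diff_divide_distrib)
    ultimately have "(\<lambda>n. w $ n / of_nat n powr \<beta>) \<longlonglongrightarrow> 1"
      using Lim_transform_eventually by force
    from growth_of_euler_op[OF less.prems _ S this]
    have "growth (Re \<beta> - real K) (w - fps_const (Gamma (\<beta> + 1)) * npow_fps (\<beta> + 1))"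
      using Suc by simp
    moreover define c where "c = (\<lambda>i. if i = 0 then Gamma (\<beta> + 1) else - (C (i - 1) / of_nat i))"
    have "w - fps_const (Gamma (\<beta> + 1)) * npow_fps (\<beta> + 1) =
        power_fps \<beta> - (\<Sum>i<K. fps_const (c i) * npow_fps (\<beta> + 1 - of_nat i))"
      unfolding Suc sum.lessThan_Suc_shift w_def c_def
      by (simp add: sum_negf algebra_simps flip: fps_const_neg)
    ultimately show ?thesis
      by (intro exI[of _ c]) (simp add: c_def C numeral_2_eq_2)
  qed
qed

section \<open>Power series at the point 1\<close>

definition real_eval :: "complex fps \<Rightarrow> real \<Rightarrow> complex" where
  "real_eval F x = (\<Sum>n. F $ n * of_real x ^ n)"

lemma summable_norm_real_eval:
  assumes "growth q F" "q < -1" "0 \<le> x" "x \<le> 1"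
  shows "summable (\<lambda>n. norm (F $ n * of_real x ^ n))"
proof (rule summable_comparison_test'[OF growth_summable_norm[OF assms(1,2)], of 0])
  fix n
  show "norm (norm (F $ n * of_real x ^ n)) \<le> norm (F $ n)"
    using assms by (simp add: norm_mult norm_power mult_left_le power_le_one)
qed

lemma sums_real_eval:
  assumes "growth q F" "q < -1" "0 \<le> x" "x \<le> 1"
  shows "(\<lambda>n. F $ n * of_real x ^ n) sums real_eval F x"
  unfolding real_eval_def
  by (intro summable_sums summable_norm_cancel[OF summable_norm_real_eval[OF assms]])

text \<open>Summable coefficients give uniform convergence up to and including 1, so values at 1 can
  be found as limits from the left.\<close>

lemma continuous_on_real_eval:
  assumes "growth q F" "q < -1"
  shows "continuous_on {0..1} (real_eval F)"
proof (rule uniform_limit_theorem)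
  show "uniform_limit {0..1} (\<lambda>N x. \<Sum>n<N. F $ n * of_real x ^ n) (real_eval F) sequentially"
    unfolding real_eval_def
  proof (rule Weierstrass_m_test)
    fix n and x :: real assume "x \<in> {0..1}"
    thus "norm (F $ n * of_real x ^ n) \<le> norm (F $ n)"
      by (simp add: norm_mult norm_power mult_left_le power_le_one)
  qed (rule growth_summable_norm[OF assms])
qed (auto intro!: always_eventually continuous_intros)

lemma real_eval_mult:
  assumes "growth q F" "q < -1" "growth r G" "r < -1" "0 \<le> x" "x \<le> 1"
  shows "real_eval (F * G) x = real_eval F x * real_eval G x"
proof -
  have "(\<lambda>k. \<Sum>i\<le>k. (F $ i * of_real x ^ i) * (G $ (k - i) * of_real x ^ (k - i))) sums
          (real_eval F x * real_eval G x)"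
    unfolding real_eval_def
    by (intro Cauchy_product_sums summable_norm_real_eval[OF assms(1,2,5,6)]
          summable_norm_real_eval[OF assms(3,4,5,6)])
  moreover have "(\<Sum>i\<le>k. (F $ i * of_real x ^ i) * (G $ (k - i) * of_real x ^ (k - i))) =
      (F * G) $ k * of_real x ^ k" for k
  proof -
    have "(F $ i * of_real x ^ i) * (G $ (k - i) * of_real x ^ (k - i)) =
        F $ i * G $ (k - i) * of_real x ^ k" if "i \<le> k" for i
      using that by (simp add: mult_ac flip: power_add)
    thus ?thesis unfolding fps_mult_nth sum_distrib_right atLeast0AtMost
      by (intro sum.cong) auto
  qed
  ultimately show ?thesis by (simp add: real_eval_def sums_iff)
qed

lemma real_eval_binom:
  assumes "norm c \<le> 1" "0 \<le> x" "x < 1"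
  shows "real_eval (binom_fps c a) x = (1 + c * of_real x) powr a"
proof -
  have "norm (c * of_real x) < 1"
    using mult_right_mono[OF assms(1), of x] assms by (simp add: norm_mult)
  from gen_binomial_complex[OF this, of a] show ?thesis
    by (simp add: real_eval_def binom_fps_nth sums_iff power_mult_distrib mult_ac)
qed

lemma growth_binom:
  assumes "norm c \<le> 1"
  shows "growth (- Re a - 1) (binom_fps c a)"
proof -
  obtain C where C: "C \<ge> 0" "\<And>n. norm (npow_fps (-a) $ n) \<le> C * (1 + real n) powr (- Re a - 1)"
    using growthE[OF growth_npow_fps[of "-a"]] by auto
  show ?thesis
  proof (rule growthI)
    fix n
    have "norm (binom_fps c a $ n) = norm c ^ n * norm (npow_fps (-a) $ n)"
      by (simp add: npow_fps_eq_binom binom_fps_nth norm_mult norm_power)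
    also have "\<dots> \<le> 1 * norm (npow_fps (-a) $ n)"
      using assms by (intro mult_right_mono power_le_one) auto
    finally show "norm (binom_fps c a $ n) \<le> C * (1 + real n) powr (- Re a - 1)"
      using C(2)[of n] by simp
  qed
qed

text \<open>With l = -ln r the product is compared with y^k / exp y at y = l (n+1), for a natural k
  \<ge> p.\<close>

lemma bounded_powr_mult_power:
  fixes r p :: real
  assumes "0 \<le> r" "r < 1"
  obtains B where "\<And>n. (1 + real n) powr p * r ^ n \<le> B"
proof -
  obtain k :: nat where k: "p \<le> real k" using real_arch_simple by blast
  show ?thesis
  proof (cases "r = 0")
    case True
    have "(1 + real n) powr p * r ^ n \<le> 1" for n using True by (cases n) auto
    thus ?thesis using that by blast
  next
    case False
    define l where "l = - ln r"
    have l: "l > 0" using assms False by (simp add: l_def)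
    have "(\<lambda>n. (l * real (Suc n)) ^ k / exp (l * real (Suc n))) \<longlonglongrightarrow> 0"
    proof (rule filterlim_compose[OF tendsto_power_div_exp_0])
      show "filterlim (\<lambda>n. l * real (Suc n)) at_top sequentially"
        by (intro filterlim_tendsto_pos_mult_at_top[OF tendsto_const l]
             filterlim_compose[OF filterlim_real_sequentially filterlim_Suc])
    qed
    hence "Bseq (\<lambda>n. (l * real (Suc n)) ^ k / exp (l * real (Suc n)))"
      by (intro convergent_imp_Bseq) (auto simp: convergent_def)
    then obtain B where B: "B > 0" "\<And>n. norm ((l * real (Suc n)) ^ k / exp (l * real (Suc n))) \<le> B"
      by (auto elim: BseqE)
    show ?thesis
    proof (rule that)
      fix n
      have r: "r ^ n = exp (- (l * real n))"
        using assms False by (simp add: l_def exp_of_nat_mult exp_of_nat2_mult)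
      have "(1 + real n) powr p * r ^ n \<le> (1 + real n) ^ k * r ^ n"
        using k powr_mono[OF k, of "1 + real n"] assms
        by (intro mult_right_mono) (auto simp: powr_realpow)
      also have "\<dots> = exp l / l ^ k * ((l * real (Suc n)) ^ k / exp (l * real (Suc n)))"
      proof -
        have "X ^ k * (exp l / Y) = exp l / l ^ k * ((l * X) ^ k / Y)" for X Y :: real
          using l by (simp add: power_mult_distrib)
        moreover have "r ^ n = exp l / exp (l * real (Suc n))"
          by (simp add: r distrib_left exp_add exp_minus field_simps)
        moreover have "1 + real n = real (Suc n)" by simp
        ultimately show ?thesis by metis
      qed
      also have "\<dots> \<le> exp l / l ^ k * B"
        using B(2)[of n] l by (intro mult_left_mono) auto
      finally show "(1 + real n) powr p * r ^ n \<le> exp l / l ^ k * B" .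
    qed
  qed
qed

lemma growth_binom_rapid:
  assumes "norm c < 1"
  shows "growth q (binom_fps c a)"
proof -
  obtain C where C: "C \<ge> 0" "\<And>n. norm (npow_fps (-a) $ n) \<le> C * (1 + real n) powr (- Re a - 1)"
    using growthE[OF growth_npow_fps[of "-a"]] by auto
  obtain B where B: "\<And>n. (1 + real n) powr (- Re a - 1 - q) * norm c ^ n \<le> B"
    using bounded_powr_mult_power[of "norm c" "- Re a - 1 - q"] assms by auto
  show ?thesis
  proof (rule growthI)
    fix n
    have "norm (binom_fps c a $ n) = norm c ^ n * norm (npow_fps (-a) $ n)"
      by (simp add: npow_fps_eq_binom binom_fps_nth norm_mult norm_power)
    also have "\<dots> \<le> norm c ^ n * (C * (1 + real n) powr (- Re a - 1))"
      by (intro mult_left_mono C) auto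
    also have "\<dots> = C * ((1 + real n) powr (- Re a - 1 - q) * norm c ^ n) * (1 + real n) powr q"
      by (simp add: powr_diff)
    also have "\<dots> \<le> C * B * (1 + real n) powr q"
      using C by (intro mult_right_mono mult_left_mono B) auto
    finally show "norm (binom_fps c a $ n) \<le> C * B * (1 + real n) powr q" .
  qed
qed

section \<open>Difference quotients at the point 1\<close>

text \<open>The difference quotient of \<open>F\<close> at \<open>1\<close>, written without division:
  \<open>F = F(1) + (1 - X) * fps_slope F\<close>.\<close>

definition fps_slope :: "complex fps \<Rightarrow> complex fps" where
  "fps_slope F = Abs_fps (\<lambda>n. (\<Sum>k\<le>n. F $ k) - real_eval F 1)"

lemma fps_slope_nth: "fps_slope F $ n = (\<Sum>k\<le>n. F $ k) - real_eval F 1"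
  by (simp add: fps_slope_def)

lemma fps_slope_eq: "F = fps_const (real_eval F 1) + (1 - fps_X) * fps_slope F"
proof (rule fps_ext)
  fix n
  show "F $ n = (fps_const (real_eval F 1) + (1 - fps_X) * fps_slope F) $ n"
    by (cases n) (simp_all add: fps_slope_nth left_diff_distrib)
qed

text \<open>The coefficients are negated tail sums of \<open>F\<close>. Splitting off a fixed
  summable power -2 bounds them at the cost of two orders; this crude loss is affordable after
  geometric decay or after raising an exponent.\<close>

lemma growth_fps_slope:
  assumes "growth q F" "q \<le> -2"
  shows "growth (q + 2) (fps_slope F)"
proof -
  obtain C where C: "C \<ge> 0" "\<And>n. norm (F $ n) \<le> C * (1 + real n) powr q"
    using growthE[OF assms(1)] by blast
  have s2: "summable (\<lambda>n. (1 + real n) powr -2)" by (rule summable_Suc_powr) simp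
  define S where "S = (\<Sum>n. (1 + real n) powr -2)"
  have sumF: "summable (\<lambda>n. norm (F $ n))"
    by (rule growth_summable_norm[OF assms(1)]) (use assms in simp)
  show ?thesis
  proof (rule growthI)
    fix n
    have "real_eval F 1 = (\<Sum>k. F $ (k + Suc n)) + (\<Sum>k<Suc n. F $ k)"
      unfolding real_eval_def using suminf_split_initial_segment[OF summable_norm_cancel[OF sumF], of "Suc n"]
      by simp
    hence "norm (fps_slope F $ n) = norm (\<Sum>k. F $ (k + Suc n))"
      by (simp add: fps_slope_nth lessThan_Suc_atMost del: sum.lessThan_Suc)
    also have "\<dots> \<le> (\<Sum>k. C * (1 + real n) powr (q + 2) * (1 + real k) powr -2)"
    proof (rule norm_suminf_le)
      show "summable (\<lambda>k. C * (1 + real n) powr (q + 2) * (1 + real k) powr -2)"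
        by (rule summable_mult[OF s2])
      fix k
      have "norm (F $ (k + Suc n)) \<le> C * (1 + real (k + Suc n)) powr q" by (rule C)
      also have "\<dots> = C * ((1 + real (k + Suc n)) powr (q + 2) * (1 + real (k + Suc n)) powr -2)"
        by (simp flip: powr_add)
      also have "\<dots> \<le> C * ((1 + real n) powr (q + 2) * (1 + real k) powr -2)"
        using assms(2) C(1) by (intro mult_left_mono mult_mono powr_mono2') auto
      finally show "norm (F $ (k + Suc n)) \<le> C * (1 + real n) powr (q + 2) * (1 + real k) powr -2"
        by (simp add: mult.assoc)
    qed
    also have "\<dots> = C * S * (1 + real n) powr (q + 2)"
      unfolding S_def using suminf_mult[OF s2, of "C * (1 + real n) powr (q + 2)"] by simp
    finally show "norm (fps_slope F $ n) \<le> C * S * (1 + real n) powr (q + 2)" .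
  qed
qed

lemma fps_slope_add:
  assumes "growth q F" "q < -1" "growth r G" "r < -1"
  shows "fps_slope (F + G) = fps_slope F + fps_slope G"
proof -
  have "real_eval (F + G) 1 = real_eval F 1 + real_eval G 1"
    using sums_add[OF sums_real_eval[OF assms(1,2), of 1] sums_real_eval[OF assms(3,4), of 1]]
    by (simp add: real_eval_def sums_iff)
  thus ?thesis by (intro fps_ext) (simp add: fps_slope_nth sum.distrib)
qed

lemma fps_slope_cmult:
  assumes "growth q F" "q < -1"
  shows "fps_slope (fps_const c * F) = fps_const c * fps_slope F"
proof -
  have "real_eval (fps_const c * F) 1 = c * real_eval F 1"
    using sums_mult[OF sums_real_eval[OF assms(1,2), of 1], of c]
    by (simp add: real_eval_def sums_iff mult.assoc)
  thus ?thesis by (intro fps_ext) (simp add: fps_slope_nth sum_distrib_left right_diff_distrib)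
qed

lemma real_eval_slope:
  assumes "growth q F" "q < -1" "growth q (fps_slope F)" "0 \<le> x" "x \<le> 1"
  shows "real_eval F x = real_eval F 1 + (1 - of_real x) * real_eval (fps_slope F) x"
proof -
  have g: "growth q (npow_fps (-1))" "growth q (fps_const c)" for c
    by (rule growth_eventually[where N = 2 and C = 0], simp add: npow_fps_minus_1 numeral_2_eq_2)
       (rule growth_const)
  have "real_eval F x = real_eval (fps_const (real_eval F 1) + npow_fps (-1) * fps_slope F) x"
    using fps_slope_eq[of F] by (simp add: npow_fps_minus_1)
  also have "\<dots> = real_eval (fps_const (real_eval F 1)) x + real_eval (npow_fps (-1) * fps_slope F) x"
    using sums_add[OF sums_real_eval[OF g(2) assms(2,4,5), of "real_eval F 1"]
        sums_real_eval[OF growth_mult[OF g(1) assms(3,2), unfolded max.idem] assms(2,4,5)]]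
    by (simp add: real_eval_def sums_iff distrib_right del: fps_nth_fps_const)
  also have "real_eval (fps_const (real_eval F 1)) x = real_eval F 1"
    using suminf_finite[of "{0}" "\<lambda>n. fps_const (real_eval F 1) $ n * of_real x ^ n"]
    by (simp add: real_eval_def)
  also have "real_eval (npow_fps (-1) * fps_slope F) x = real_eval (npow_fps (-1)) x * real_eval (fps_slope F) x"
    by (rule real_eval_mult[OF g(1) assms(2,3,2,4,5)])
  also have "real_eval (npow_fps (-1)) x = 1 - of_real x"
    using suminf_finite[of "{0,1}" "\<lambda>n. npow_fps (-1) $ n * of_real x ^ n"]
    by (auto simp: real_eval_def npow_fps_minus_1)
  finally show ?thesis .
qed

text \<open>Applying \<open>fps_slope_eq\<close> twice gives the shape; the two constants are found
  by letting x tend to 1 from the left. Continuity identifies F(1) with f(1), and the difference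
  quotient identifies the slope at 1 with -d, the sign coming from 1 - x in place of x - 1.\<close>

lemma fps_quadratic_expansion:
  fixes f :: "real \<Rightarrow> real"
  assumes "q < -1" "growth q F" "growth q (fps_slope F)" "growth q (fps_slope (fps_slope F))"
    and eval: "\<And>x. 0 \<le> x \<Longrightarrow> x < 1 \<Longrightarrow> real_eval F x = of_real (f x)"
    and deriv: "(f has_real_derivative d) (at 1)"
  shows "F = fps_const (of_real (f 1)) - fps_const (of_real d) * (1 - fps_X)
             + (1 - fps_X) * (1 - fps_X) * fps_slope (fps_slope F)"
proof -
  have lim: "(real_eval G \<longlongrightarrow> real_eval G 1) (at_left 1)" if "growth q G" for G
  proof -
    have "(real_eval G \<longlongrightarrow> real_eval G 1) (at 1 within {0..1})"
      using continuous_on_real_eval[OF that assms(1)] by (simp add: continuous_on_def)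
    thus ?thesis by (simp add: at_within_Icc_at_left)
  qed
  have ev: "eventually (\<lambda>x::real. 0 \<le> x \<and> x < 1) (at_left 1)"
    using eventually_at_left_real[of 0 "1::real"] by (auto elim: eventually_mono)
  have "(f \<longlongrightarrow> f 1) (at_left 1)"
    using DERIV_isCont[OF deriv] by (simp add: isCont_def filterlim_at_split)
  hence "((\<lambda>x. of_real (f x) :: complex) \<longlongrightarrow> of_real (f 1)) (at_left 1)"
    by (intro tendsto_intros)
  moreover have "((\<lambda>x. of_real (f x) :: complex) \<longlongrightarrow> real_eval F 1) (at_left 1)"
    by (rule Lim_transform_eventually[OF lim[OF assms(2)]])
       (use ev in eventually_elim, use eval in auto)
  ultimately have f1: "real_eval F 1 = of_real (f 1)"
    using tendsto_unique trivial_limit_at_left_real by blast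
  have "((\<lambda>x. (f x - f 1) / (x - 1)) \<longlongrightarrow> d) (at_left 1)"
    using deriv unfolding has_field_derivative_iff by (simp add: filterlim_at_split)
  hence "((\<lambda>x. - of_real ((f x - f 1) / (x - 1)) :: complex) \<longlongrightarrow> - of_real d) (at_left 1)"
    by (intro tendsto_intros)
  moreover have "((\<lambda>x. - of_real ((f x - f 1) / (x - 1)) :: complex) \<longlongrightarrow> real_eval (fps_slope F) 1) (at_left 1)"
  proof (rule Lim_transform_eventually[OF lim[OF assms(3)]])
    show "eventually (\<lambda>x. real_eval (fps_slope F) x = - of_real ((f x - f 1) / (x - 1))) (at_left 1)"
      using ev
    proof eventually_elim
      case (elim x)
      hence x: "1 - complex_of_real x \<noteq> 0" by (metis eq_iff_diff_eq_0 of_real_1 of_real_eq_iff order_less_irrefl)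
      have "of_real (f x) = of_real (f 1) + (1 - of_real x) * real_eval (fps_slope F) x"
        using real_eval_slope[OF assms(2,1,3), of x] elim eval[of x] f1 by simp
      hence "real_eval (fps_slope F) x = (of_real (f x) - of_real (f 1)) / (1 - of_real x)"
        using x by (simp add: field_simps)
      also have "\<dots> = - of_real ((f x - f 1) / (x - 1))"
        by (simp add: minus_divide_right)
      finally show ?case .
    qed
  qed
  ultimately have f2: "real_eval (fps_slope F) 1 = - of_real d"
    using tendsto_unique trivial_limit_at_left_real by blast
  have "F = fps_const (real_eval F 1) + (1 - fps_X) *
          (fps_const (real_eval (fps_slope F) 1) + (1 - fps_X) * fps_slope (fps_slope F))"
    using fps_slope_eq[of F] fps_slope_eq[of "fps_slope F"] by simp
  thus ?thesis by (simp add: f1 f2 algebra_simps flip: fps_const_neg)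
qed

section \<open>The weights\<close>

lemma growth_binom_1_1: "growth q (binom_fps 1 1)"
  by (rule growth_eventually[where N = 2 and C = 0]) (auto simp: binom_fps_1 numeral_2_eq_2)

text \<open>Since \<open>1 + X = 2 - (1 - X)\<close>, multiplying \<open>F\<close> by \<open>1 + X\<close> doubles the difference
  quotient and subtracts \<open>F\<close>. So the decay of the difference quotient of \<open>(1 + X) powr a\<close> can be
  read off the faster decaying one of \<open>(1 + X) powr (a + 1)\<close>.\<close>

lemma fps_slope_binom_1:
  assumes "Re a > 0"
  shows "fps_slope (binom_fps 1 a) =
           fps_const (1/2) * (fps_slope (binom_fps 1 (a + 1)) + binom_fps 1 a)"
proof -
  let ?F = "binom_fps 1 a"
  have eq: "binom_fps 1 (a + 1) = binom_fps 1 1 * ?F"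
    by (simp add: binom_fps_add mult.commute)
  have "real_eval (binom_fps 1 (a + 1)) 1 = real_eval (binom_fps 1 1) 1 * real_eval ?F 1"
    unfolding eq
    by (rule real_eval_mult[OF growth_binom_1_1[of "-2"] _ growth_binom[of 1 a]]) (use assms in auto)
  also have "real_eval (binom_fps 1 1) 1 = 2"
    using suminf_finite[of "{0,1}" "\<lambda>n. binom_fps 1 1 $ n * of_real 1 ^ n"]
    by (auto simp: real_eval_def binom_fps_1)
  finally have ev: "real_eval (binom_fps 1 (a + 1)) 1 = 2 * real_eval ?F 1" .
  have "fps_slope (binom_fps 1 (a + 1)) $ n = 2 * fps_slope ?F $ n - ?F $ n" for n
  proof -
    have sh: "(\<Sum>k\<le>n. (fps_X * ?F) $ k) + ?F $ n = (\<Sum>k\<le>n. ?F $ k)"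
      by (induction n) auto
    have "(\<Sum>k\<le>n. binom_fps 1 (a + 1) $ k) = (\<Sum>k\<le>n. ?F $ k) + (\<Sum>k\<le>n. (fps_X * ?F) $ k)"
      unfolding eq binom_fps_1 by (simp add: distrib_right sum.distrib)
    also have "(\<Sum>k\<le>n. (fps_X * ?F) $ k) = (\<Sum>k\<le>n. ?F $ k) - ?F $ n"
      using sh by (simp add: algebra_simps)
    finally show ?thesis unfolding fps_slope_nth ev by (simp add: algebra_simps)
  qed
  thus ?thesis by (intro fps_ext) simp
qed

text \<open>The crude bound loses two orders, so it is applied at exponent a + 2, where the
  coefficients decay two orders faster. Two descents by \<open>fps_slope_binom_1\<close> return to
  \<open>a\<close> without further loss.\<close>

lemma growth_slope_binom_1:
  assumes "Re a > 0"
  shows "growth (- Re a - 1) (fps_slope (binom_fps 1 a))"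
proof -
  have step: "growth (- Re a - 1) (fps_slope (binom_fps 1 b))"
    if "growth (- Re a - 1) (fps_slope (binom_fps 1 (b + 1)))" "Re b \<ge> Re a" for b
    unfolding fps_slope_binom_1[OF order_less_le_trans[OF assms that(2)]]
    by (intro growth_cmult growth_add that(1) growth_mono[OF growth_binom]) (use that(2) in auto)
  have "growth (- Re (a + 2) - 1 + 2) (fps_slope (binom_fps 1 (a + 2)))"
    by (intro growth_fps_slope growth_binom) (use assms in auto)
  moreover have "- Re (a + 2) - 1 + 2 = - Re a - 1" "a + 2 = a + 1 + 1" by simp_all
  ultimately have "growth (- Re a - 1) (fps_slope (binom_fps 1 (a + 1 + 1)))"
    by (simp only:)
  from step[OF step[OF this]] show ?thesis by simp
qed

text \<open>The same detour through a + 2, now for the slope of the slope; linearity of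
  \<open>fps_slope\<close> transfers the descent formula.\<close>

lemma growth_slope_slope_binom_1:
  assumes "Re a > 0"
  shows "growth (- Re a - 1) (fps_slope (fps_slope (binom_fps 1 a)))"
proof -
  have step: "growth (- Re a - 1) (fps_slope (fps_slope (binom_fps 1 b)))"
    if "growth (- Re a - 1) (fps_slope (fps_slope (binom_fps 1 (b + 1))))" "Re b \<ge> Re a" for b
  proof -
    have b: "Re b > 0" "Re (b + 1) > 0" using assms that by auto
    have g: "growth (- Re b - 1) (fps_slope (binom_fps 1 (b + 1)))" "growth (- Re b - 1) (binom_fps 1 b)"
      using growth_mono[OF growth_slope_binom_1[OF b(2)]] growth_binom[of 1 b] by auto
    have "fps_slope (fps_slope (binom_fps 1 b)) =
        fps_const (1/2) * (fps_slope (fps_slope (binom_fps 1 (b + 1))) + fps_slope (binom_fps 1 b))"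
      unfolding fps_slope_binom_1[OF b(1)]
      using fps_slope_cmult[OF growth_add[OF g], of "1/2"] fps_slope_add[OF g(1) _ g(2)] b fps_slope_binom_1[OF b(1)]
      by simp
    thus ?thesis
      using growth_cmult[OF growth_add[OF that(1) growth_mono[OF growth_slope_binom_1[OF b(1)]]]] that(2)
      by simp
  qed
  have "growth (- Re (a + 2) - 1 + 2) (fps_slope (fps_slope (binom_fps 1 (a + 2))))"
    by (intro growth_fps_slope growth_slope_binom_1) (use assms in auto)
  moreover have "- Re (a + 2) - 1 + 2 = - Re a - 1" "a + 2 = a + 1 + 1" by simp_all
  ultimately have "growth (- Re a - 1) (fps_slope (fps_slope (binom_fps 1 (a + 1 + 1))))"
    by (simp only:)
  from step[OF step[OF this]] show ?thesis by simp
qed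

section \<open>The generating function of the weights\<close>

lemma of_real_gchoose: "of_real (a gchoose k) = (of_real a gchoose k :: complex)"
  by (simp add: gbinomial_prod_rev)

text \<open>What is left of the generating function after taking out (1 - X) powr (-\<alpha>): the
  denominator factors as (1 - \<xi>) ((3/2 - \<theta>) - (1/2 - \<theta>) \<xi>), and constants are
  pulled out of the other two linear factors.\<close>

definition bt_factor :: "real \<Rightarrow> real \<Rightarrow> complex fps" where
  "bt_factor \<alpha> \<theta> = fps_const (of_real ((2 * (1 - \<theta>) / (3 - 2 * \<theta>)) powr \<alpha>)) *
     (binom_fps (of_real (\<theta> / (1 - \<theta>))) (of_real \<alpha>) *
      binom_fps (- of_real ((1 - 2 * \<theta>) / (3 - 2 * \<theta>))) (- of_real \<alpha>))"

definition bt_fps :: "real \<Rightarrow> real \<Rightarrow> complex fps" where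
  "bt_fps \<alpha> \<theta> = Abs_fps (\<lambda>n. of_real (bt_weight \<alpha> \<theta> n))"

lemma bt_fps_eq: "bt_fps \<alpha> \<theta> = npow_fps (of_real \<alpha>) * bt_factor \<alpha> \<theta>"
proof -
  let ?A = "binom_fps (of_real (\<theta> / (1 - \<theta>))) (of_real \<alpha>)"
  let ?B = "binom_fps (- of_real ((1 - 2 * \<theta>) / (3 - 2 * \<theta>))) (- of_real \<alpha>)"
  have k1: "of_real (kappa1 \<alpha> \<theta> k) = ?A $ k" for k
    by (simp add: kappa1_def binom_fps_nth of_real_gchoose)
  have k2: "of_real (kappa2 \<alpha> \<theta> k) = ?B $ k" for k
    by (simp add: kappa2_def binom_fps_nth of_real_gchoose)
  have k3: "of_real (kappa3 \<alpha> k) = npow_fps (of_real \<alpha>) $ k" for k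
    by (simp add: kappa3_def npow_fps_eq_binom binom_fps_nth of_real_gchoose)
  have "bt_fps \<alpha> \<theta> = fps_const (of_real ((2 * (1 - \<theta>) / (3 - 2 * \<theta>)) powr \<alpha>)) *
     (?A * (?B * npow_fps (of_real \<alpha>)))"
  proof (rule fps_ext)
    fix n
    have "bt_fps \<alpha> \<theta> $ n = of_real ((2 * (1 - \<theta>) / (3 - 2 * \<theta>)) powr \<alpha>) *
        (\<Sum>k=0..n. \<Sum>s=0..n-k. of_real (kappa1 \<alpha> \<theta> k) * of_real (kappa2 \<alpha> \<theta> s) * of_real (kappa3 \<alpha> (n - k - s)))"
      by (simp add: bt_fps_def bt_weight_def)
    also have "\<dots> = (fps_const (of_real ((2 * (1 - \<theta>) / (3 - 2 * \<theta>)) powr \<alpha>)) *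
        (?A * (?B * npow_fps (of_real \<alpha>)))) $ n"
      unfolding k1 k2 k3
      by (simp only: fps_mult_left_const_nth) (simp only: fps_mult_nth sum_distrib_left mult.assoc)
    finally show "bt_fps \<alpha> \<theta> $ n = \<dots>" .
  qed
  thus ?thesis by (simp add: bt_factor_def mult_ac)
qed

lemma bt_factor_growth:
  assumes "\<alpha> \<le> 0 \<Longrightarrow> \<theta> < 1 / 2" "\<alpha> > 0 \<Longrightarrow> \<theta> \<le> 1 / 2"
  obtains q where "q < -1" "q \<le> \<alpha> - 1" "growth q (bt_factor \<alpha> \<theta>)"
    "growth q (fps_slope (bt_factor \<alpha> \<theta>))" "growth q (fps_slope (fps_slope (bt_factor \<alpha> \<theta>)))"
proof (cases "\<theta> = 1/2")
  case True
  hence \<alpha>: "\<alpha> > 0" using assms(1) by force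
  have one: "binom_fps 0 a = 1" for a
    by (rule fps_ext) (simp add: binom_fps_nth power_0_left)
  have eq: "bt_factor \<alpha> \<theta> = fps_const (of_real ((1/2) powr \<alpha>)) * binom_fps 1 (of_real \<alpha>)"
    unfolding True bt_factor_def by (simp add: one)
  have g: "growth (- \<alpha> - 1) (binom_fps 1 (of_real \<alpha>))" using growth_binom[of 1 "of_real \<alpha>"] by simp
  have g': "growth (- \<alpha> - 1) (fps_slope (binom_fps 1 (of_real \<alpha>)))"
    using growth_slope_binom_1[of "of_real \<alpha>"] \<alpha> by simp
  have g'': "growth (- \<alpha> - 1) (fps_slope (fps_slope (binom_fps 1 (of_real \<alpha>))))"
    using growth_slope_slope_binom_1[of "of_real \<alpha>"] \<alpha> by simp
  have q: "- \<alpha> - 1 < -1" "-\<alpha> - 1 \<le> \<alpha> - 1" using \<alpha> by auto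
  show ?thesis
  proof (rule that[OF q])
    show "growth (- \<alpha> - 1) (bt_factor \<alpha> \<theta>)" unfolding eq by (rule growth_cmult[OF g])
    show "growth (- \<alpha> - 1) (fps_slope (bt_factor \<alpha> \<theta>))"
      unfolding eq fps_slope_cmult[OF g q(1)] by (rule growth_cmult[OF g'])
    show "growth (- \<alpha> - 1) (fps_slope (fps_slope (bt_factor \<alpha> \<theta>)))"
      unfolding eq fps_slope_cmult[OF g q(1)] fps_slope_cmult[OF g' q(1)] by (rule growth_cmult[OF g''])
  qed
next
  case False
  hence \<theta>: "\<theta> < 1/2" using assms by linarith
  \<comment> \<open>The bound -2 gives summability; \<alpha> - 1 is the order that the remainder may
    have in the final estimate.\<close>
  define q where "q = min (-2) (\<alpha> - 1)"
  have a: "norm (of_real (\<theta> / (1 - \<theta>)) :: complex) < 1"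
    using \<theta> by (simp only: norm_of_real) (auto simp: abs_if field_simps)
  have c: "norm (- of_real ((1 - 2 * \<theta>) / (3 - 2 * \<theta>)) :: complex) < 1"
    using \<theta> by (simp only: norm_minus_cancel norm_of_real) (auto simp: abs_if field_simps)
  \<comment> \<open>Each of the two crude difference quotients costs two orders, so four are set
    aside.\<close>
  have g: "growth (q - 4) (bt_factor \<alpha> \<theta>)"
    unfolding bt_factor_def
    by (rule growth_cmult, rule growth_mult[OF growth_binom_rapid[OF a, of "q-4"] growth_binom_rapid[OF c, of "q-4"], unfolded max.idem])
       (simp add: q_def)
  have g': "growth (q - 2) (fps_slope (bt_factor \<alpha> \<theta>))"
    using growth_fps_slope[OF g] by (simp add: q_def)
  have g'': "growth q (fps_slope (fps_slope (bt_factor \<alpha> \<theta>)))"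
    using growth_fps_slope[OF g'] by (simp add: q_def)
  have "q < -1" "q \<le> \<alpha> - 1" by (auto simp: q_def)
  thus ?thesis
    by (rule that) (use growth_mono[OF g, of q] growth_mono[OF g', of q] g'' in simp_all)
qed

lemma bt_factor_eval:
  assumes "\<theta> \<le> 1/2" "0 \<le> x" "x < 1" "\<alpha> \<le> 0 \<Longrightarrow> \<theta> < 1 / 2"
  shows "real_eval (bt_factor \<alpha> \<theta>) x = of_real ((2 * (1 - \<theta>) / (3 - 2 * \<theta>)) powr \<alpha> *
      ((1 + \<theta> / (1 - \<theta>) * x) powr \<alpha> * (1 - (1 - 2 * \<theta>) / (3 - 2 * \<theta>) * x) powr (-\<alpha>)))"
proof -
  define a where "a = \<theta> / (1 - \<theta>)"
  define c where "c = (1 - 2 * \<theta>) / (3 - 2 * \<theta>)"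
  have "\<alpha> > 0" if "\<theta> = 1/2" using assms(4) that by force
  hence a: "\<bar>a\<bar> \<le> 1" "\<bar>a\<bar> < 1 \<or> a = 1 \<and> \<alpha> > 0"
    using assms(1) by (auto simp: a_def abs_if field_simps)
  have c: "\<bar>c\<bar> < 1" using assms(1) by (auto simp: c_def abs_if field_simps)
  let ?A = "binom_fps (of_real a) (of_real \<alpha>)"
  let ?B = "binom_fps (- of_real c) (- of_real \<alpha>)"
  obtain q where q: "q < -1" "growth q ?A"
  proof (cases "\<bar>a\<bar> < 1")
    case True
    thus ?thesis using that[of "-2"] growth_binom_rapid[of "of_real a" "-2"] by simp
  next
    case False
    thus ?thesis using that[of "-\<alpha>-1"] a growth_binom[of "of_real a" "of_real \<alpha>"] by simp
  qed
  have B: "growth (-2) ?B" by (rule growth_binom_rapid) (use c in auto)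
  have x: "x \<le> 1" using assms by simp
  have "real_eval (fps_const k * F) x = k * real_eval F x" if "growth r F" "r < -1" for k F r
    using sums_mult[OF sums_real_eval[OF that assms(2) x], of k]
    by (simp add: real_eval_def sums_iff mult.assoc)
  note cm = this[OF growth_mult[OF q(2) B]]
  have "\<bar>a * x\<bar> < 1" "\<bar>c * x\<bar> < 1"
    using a(1) c assms mult_mono[of "\<bar>a\<bar>" 1 x x] mult_mono[of "\<bar>c\<bar>" 1 x x] by (auto simp: abs_mult)
  hence pos: "1 + a * x > 0" "1 - c * x > 0" by linarith+
  have "real_eval (bt_factor \<alpha> \<theta>) x = of_real ((2 * (1 - \<theta>) / (3 - 2 * \<theta>)) powr \<alpha>) * real_eval (?A * ?B) x"
    unfolding bt_factor_def a_def[symmetric] c_def[symmetric] by (rule cm) (use q in auto)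
  also have "real_eval (?A * ?B) x = real_eval ?A x * real_eval ?B x"
    by (rule real_eval_mult[OF q(2,1) B _ assms(2) x]) simp
  also have "real_eval ?A x = of_real (1 + a * x) powr of_real \<alpha>"
    using a(1) assms by (subst real_eval_binom) auto
  also have "\<dots> = of_real ((1 + a * x) powr \<alpha>)"
    using pos by (intro powr_of_real) auto
  also have "real_eval ?B x = of_real (1 - c * x) powr of_real (-\<alpha>)"
    using c assms by (subst real_eval_binom) auto
  also have "\<dots> = of_real ((1 - c * x) powr (-\<alpha>))"
    using pos by (intro powr_of_real) auto
  finally show ?thesis unfolding a_def c_def by simp
qed

lemma bt_fps_expansion:
  assumes "\<alpha> \<le> 0 \<Longrightarrow> \<theta> < 1 / 2" "\<alpha> > 0 \<Longrightarrow> \<theta> \<le> 1 / 2"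
  obtains q G where "q < -1" "q \<le> \<alpha> - 1" "growth q G"
    "bt_fps \<alpha> \<theta> = npow_fps (of_real \<alpha>) * (1 - fps_const (of_real (\<alpha> / 2)) * (1 - fps_X) +
       (1 - fps_X) * (1 - fps_X) * G)"
proof -
  obtain q where q: "q < -1" "q \<le> \<alpha> - 1" "growth q (bt_factor \<alpha> \<theta>)"
    "growth q (fps_slope (bt_factor \<alpha> \<theta>))" "growth q (fps_slope (fps_slope (bt_factor \<alpha> \<theta>)))"
    using bt_factor_growth[OF assms] by blast
  have \<theta>: "\<theta> \<le> 1/2" using assms by linarith
  define a where "a = \<theta> / (1 - \<theta>)"
  define c where "c = (1 - 2 * \<theta>) / (3 - 2 * \<theta>)"
  define K where "K = 2 * (1 - \<theta>) / (3 - 2 * \<theta>)"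
  define f where "f = (\<lambda>x::real. K powr \<alpha> * ((1 + a * x) powr \<alpha> * (1 - c * x) powr (-\<alpha>)))"
  have a1: "1 + a = 1 / (1 - \<theta>)" using \<theta> by (simp add: a_def field_simps)
  have c1: "1 - c = 2 / (3 - 2 * \<theta>)" using \<theta> by (simp add: c_def field_simps)
  have pos: "1 + a > 0" "1 - c > 0" "K > 0" using \<theta> by (auto simp: a1 c1 K_def)
  have "K * (1 + a) / (1 - c) = 1" using \<theta> by (simp add: a1 c1 K_def)
  hence "(K * (1 + a) / (1 - c)) powr \<alpha> = 1" by (simp only: powr_one_eq_one)
  hence f1: "K powr \<alpha> * ((1 + a) powr \<alpha> * (1 - c) powr (-\<alpha>)) = 1"
    using pos by (simp add: powr_mult powr_divide powr_minus_divide)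
  \<comment> \<open>The logarithmic derivative of g at 1, divided by \<alpha>. The two parts are
    \<theta> and (1 - 2\<theta>)/2, so \<theta> drops out; this is the consistency condition of
    order 2.\<close>
  have ac: "a / (1 + a) + c / (1 - c) = 1/2"
  proof -
    have "a / (1 + a) = \<theta>" using \<theta> unfolding a1 by (simp add: a_def)
    moreover have "c / (1 - c) = (1 - 2 * \<theta>) / 2" using \<theta> unfolding c1 by (simp add: c_def)
    ultimately show ?thesis by (simp add: field_simps)
  qed
  have "(f has_real_derivative (K powr \<alpha> * ((1 + a) powr \<alpha> * (1 - c) powr (-\<alpha>))) * (\<alpha> * (a / (1 + a) + c / (1 - c)))) (at 1)"
    unfolding f_def using pos
    by (auto intro!: derivative_eq_intros simp: powr_diff field_simps)
  hence deriv: "(f has_real_derivative \<alpha> / 2) (at 1)" by (simp add: f1 ac)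
  have "bt_factor \<alpha> \<theta> = fps_const (of_real (f 1)) - fps_const (of_real (\<alpha> / 2)) * (1 - fps_X)
             + (1 - fps_X) * (1 - fps_X) * fps_slope (fps_slope (bt_factor \<alpha> \<theta>))"
    by (rule fps_quadratic_expansion[OF q(1,3-5) _ deriv])
       (simp add: bt_factor_eval[OF \<theta> _ _ assms(1)] f_def K_def a_def c_def)
  moreover have "f 1 = 1" using f1 by (simp add: f_def)
  ultimately have "bt_factor \<alpha> \<theta> = 1 - fps_const (of_real (\<alpha> / 2)) * (1 - fps_X)
             + (1 - fps_X) * (1 - fps_X) * fps_slope (fps_slope (bt_factor \<alpha> \<theta>))" by simp
  with bt_fps_eq[of \<alpha> \<theta>] show ?thesis using that[OF q(1,2,5)] by simp
qed

section \<open>The Beta integral with a complex exponent\<close>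

definition beta_kernel :: "real \<Rightarrow> complex \<Rightarrow> real \<Rightarrow> complex" where
  "beta_kernel \<alpha> \<beta> s = of_real ((1 - s) powr (\<alpha> - 1)) * of_real s powr \<beta>"

lemma norm_beta_kernel:
  "0 \<le> s \<Longrightarrow> norm (beta_kernel \<alpha> \<beta> s) = s powr Re \<beta> * (1 - s) powr (\<alpha> - 1)"
  using norm_powr_real_powr[of "of_real s" \<beta>] by (simp add: beta_kernel_def norm_mult)

lemma has_integral_Beta_powr:
  fixes \<alpha> b :: real
  assumes "\<alpha> > 0" "b > -1"
  shows "((\<lambda>s. s powr b * (1 - s) powr (\<alpha> - 1)) has_integral Beta (b + 1) \<alpha>) {0..1}"
  using has_integral_Beta_real[of "b + 1" \<alpha>] assms by simp

lemma continuous_beta_kernel: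
  assumes "0 < s" "s < 1"
  shows "isCont (beta_kernel \<alpha> \<beta>) s"
proof -
  have "isCont (\<lambda>s. (1 - s) powr (\<alpha> - 1)) s"
    using assms by (intro continuous_intros) auto
  moreover have "isCont (\<lambda>s. complex_of_real s powr \<beta>) s"
    using assms by (intro continuous_intros) auto
  ultimately show ?thesis
    unfolding beta_kernel_def[abs_def] by (rule continuous_mult[OF continuous_of_real])
qed

lemma beta_kernel_integrable:
  assumes "\<alpha> > 0" "Re \<beta> > -1"
  shows "beta_kernel \<alpha> \<beta> integrable_on {0..1}"
proof -
  have "beta_kernel \<alpha> \<beta> absolutely_integrable_on {0<..<1}"
  proof (rule measurable_bounded_by_integrable_imp_absolutely_integrable)
    show "beta_kernel \<alpha> \<beta> \<in> borel_measurable (lebesgue_on {0<..<1})"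
      by (rule continuous_imp_measurable_on_sets_lebesgue)
         (auto intro!: continuous_at_imp_continuous_on continuous_beta_kernel)
    show "(\<lambda>s. s powr Re \<beta> * (1 - s) powr (\<alpha> - 1)) integrable_on {0<..<1}"
      using has_integral_Beta_powr[OF assms] has_integral_Icc_iff_Ioo has_integral_integrable by blast
  qed (auto simp: norm_beta_kernel)
  thus ?thesis
    by (auto simp: absolutely_integrable_on_def integrable_on_def has_integral_Icc_iff_Ioo)
qed

text \<open>Integration by parts: the derivative of s powr (\<beta>+1) times (1 - s) powr \<alpha>
  is this combination of kernels, and the boundary values vanish. The derivative may blow up at the
  ends, hence the interior form of the fundamental theorem.\<close>

lemma integral_beta_kernel_rec:
  assumes "\<alpha> > 0" "Re \<beta> > -1"
  shows "(\<beta> + 1) * integral {0..1} (beta_kernel \<alpha> \<beta>) =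
         (of_real \<alpha> + \<beta> + 1) * integral {0..1} (beta_kernel \<alpha> (\<beta> + 1))"
proof -
  let ?F = "\<lambda>s. of_real s powr (\<beta> + 1) * of_real ((1 - s) powr \<alpha>)"
  let ?g = "\<lambda>s. (\<beta> + 1) * beta_kernel \<alpha> \<beta> s - (of_real \<alpha> + \<beta> + 1) * beta_kernel \<alpha> (\<beta> + 1) s"
  have 1: "(?g has_integral (?F 1 - ?F 0)) {0..1}"
  proof (rule fundamental_theorem_of_calculus_interior)
    show "continuous_on {0..1} ?F"
    proof (rule continuous_on_mult)
      show "continuous_on {0..1} (\<lambda>s. complex_of_real s powr (\<beta> + 1))"
        using assms by (intro continuous_on_powr_complex continuous_intros) auto
      have "continuous_on {0..1} (\<lambda>s::real. (1 - s) powr \<alpha>)"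
        using assms by (intro continuous_on_powr' continuous_intros) auto
      thus "continuous_on {0..1} (\<lambda>s. complex_of_real ((1 - s) powr \<alpha>))"
        by (rule continuous_on_of_real)
    qed
    fix s :: real assume s: "s \<in> {0<..<1}"
    have "((\<lambda>s. (1 - s) powr \<alpha>) has_real_derivative (- \<alpha> * (1 - s) powr (\<alpha> - 1))) (at s)"
      using s by (auto intro!: derivative_eq_intros)
    hence 1: "((\<lambda>s. complex_of_real ((1 - s) powr \<alpha>)) has_vector_derivative of_real (- \<alpha> * (1 - s) powr (\<alpha> - 1))) (at s)"
      by (intro has_vector_derivative_of_real) (simp add: has_real_derivative_iff_has_vector_derivative)
    have 2: "((\<lambda>s. of_real s powr (\<beta> + 1)) has_vector_derivative (\<beta> + 1) * of_real s powr \<beta>) (at s)"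
      using s by (auto intro!: derivative_eq_intros has_vector_derivative_real_field)
    have "?g s = of_real s powr (\<beta> + 1) * of_real (- \<alpha> * (1 - s) powr (\<alpha> - 1)) +
              (\<beta> + 1) * of_real s powr \<beta> * of_real ((1 - s) powr \<alpha>)"
    proof -
      have 1: "(1 - s) powr \<alpha> = (1 - s) * (1 - s) powr (\<alpha> - 1)"
        using s by (simp add: powr_diff)
      have 2: "complex_of_real s powr (\<beta> + 1) = of_real s * of_real s powr \<beta>"
        using s by (simp add: powr_add mult.commute)
      have "(\<beta> + 1) * (of_real P * Q) - (of_real \<alpha> + \<beta> + 1) * (of_real P * (of_real s * Q)) =
          of_real s * Q * of_real (- \<alpha> * P) + (\<beta> + 1) * Q * of_real ((1 - s) * P)" for P Q
        by (simp add: algebra_simps)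
      thus ?thesis unfolding beta_kernel_def 1 2 .
    qed
    thus "(?F has_vector_derivative ?g s) (at s)"
      using has_vector_derivative_mult[OF 2 1] by (simp only:)
  qed auto
  have 2: "?F 1 - ?F 0 = 0" using assms by simp
  have 3: "(?g has_integral ((\<beta> + 1) * integral {0..1} (beta_kernel \<alpha> \<beta>) -
       (of_real \<alpha> + \<beta> + 1) * integral {0..1} (beta_kernel \<alpha> (\<beta> + 1)))) {0..1}"
    using assms
    by (intro has_integral_diff has_integral_mult_right integrable_integral beta_kernel_integrable) auto
  show ?thesis using has_integral_unique[OF 1[unfolded 2] 3] by simp
qed

lemma integral_beta_kernel_poch:
  assumes "\<alpha> > 0" "Re \<beta> > -1"
  shows "pochhammer (\<beta> + 1) N * integral {0..1} (beta_kernel \<alpha> \<beta>) =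
         pochhammer (of_real \<alpha> + \<beta> + 1) N * integral {0..1} (beta_kernel \<alpha> (\<beta> + of_nat N))"
proof (induction N)
  case (Suc N)
  have "pochhammer (\<beta> + 1) (Suc N) * integral {0..1} (beta_kernel \<alpha> \<beta>) =
     pochhammer (of_real \<alpha> + \<beta> + 1) N * ((\<beta> + of_nat N + 1) * integral {0..1} (beta_kernel \<alpha> (\<beta> + of_nat N)))"
    using Suc by (simp add: pochhammer_Suc mult_ac add_ac)
  also have "(\<beta> + of_nat N + 1) * integral {0..1} (beta_kernel \<alpha> (\<beta> + of_nat N)) =
      (of_real \<alpha> + (\<beta> + of_nat N) + 1) * integral {0..1} (beta_kernel \<alpha> (\<beta> + of_nat N + 1))"
    by (rule integral_beta_kernel_rec) (use assms in auto)
  finally show ?case by (simp add: pochhammer_Suc mult_ac add_ac)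
qed auto

text \<open>Mean value inequality on the segment from s to 1, where Re \<gamma> \<ge> 1 bounds the
  derivative by the norm of \<gamma>. At s = 0, where the power is not differentiable, the claim
  reads 1 \<le> norm \<gamma>.\<close>

lemma norm_powr_minus_1_le:
  assumes "Re \<gamma> \<ge> 1" "0 \<le> s" "s \<le> 1"
  shows "norm (of_real s powr \<gamma> - 1) \<le> norm \<gamma> * (1 - s)"
proof (cases "s = 0")
  case True
  have "1 \<le> norm \<gamma>" using assms(1) complex_Re_le_cmod[of \<gamma>] by linarith
  thus ?thesis using True by simp
next
  case False
  let ?S = "complex_of_real ` {s..1}"
  have "norm ((\<lambda>z. z powr \<gamma>) 1 - (\<lambda>z. z powr \<gamma>) (of_real s)) \<le> norm \<gamma> * norm (1 - complex_of_real s)"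
  proof (rule field_differentiable_bound)
    show "convex ?S"
      by (intro convex_linear_image convex_real_interval bounded_linear.linear bounded_linear_of_real)
    fix z assume "z \<in> ?S"
    then obtain t where t: "z = of_real t" "s \<le> t" "t \<le> 1" by auto
    hence "t > 0" using False assms by simp
    thus "((\<lambda>z. z powr \<gamma>) has_field_derivative \<gamma> * z powr (\<gamma> - 1)) (at z within ?S)"
      by (auto simp: t(1) intro!: derivative_eq_intros)
    have "t powr (Re \<gamma> - 1) \<le> 1 powr (Re \<gamma> - 1)"
      using t \<open>t > 0\<close> assms by (intro powr_mono2) auto
    thus "norm (\<gamma> * z powr (\<gamma> - 1)) \<le> norm \<gamma>"
      using \<open>t > 0\<close> norm_powr_real_powr[of z "\<gamma> - 1"]
      by (simp add: t(1) norm_mult mult_left_le)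
  qed (use assms in auto)
  moreover have "norm (1 - complex_of_real s) = 1 - s"
  proof -
    have "norm (complex_of_real (1 - s)) = 1 - s"
      using assms by (simp only: norm_of_real abs_of_nonneg diff_ge_0_iff_ge)
    thus ?thesis by simp
  qed
  ultimately show ?thesis by (simp add: norm_minus_commute)
qed

text \<open>Shifting \<open>\<gamma>\<close> by \<open>N\<close> with the recurrence and letting \<open>N\<close> tend to infinity reduces the complex
  exponent to the real Beta integral, because \<open>s powr \<gamma>\<close> is close to \<open>1\<close> where the mass of
  \<open>s powr N\<close> lies.\<close>

lemma integral_beta_kernel_large:
  assumes \<alpha>: "\<alpha> > 0" and \<gamma>: "Re \<gamma> \<ge> 1"
  shows "integral {0..1} (beta_kernel \<alpha> \<gamma>) =
           of_real (Gamma \<alpha>) * Gamma (\<gamma> + 1) * rGamma (of_real \<alpha> + \<gamma> + 1)"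
proof -
  let ?I = "\<lambda>N. integral {0..1} (beta_kernel \<alpha> (\<gamma> + of_nat N))"
  let ?J = "\<lambda>N. integral {0..1} (beta_kernel \<alpha> (of_nat N))"
  have J: "?J N = of_real (Beta (real N + 1) \<alpha>)" for N
  proof -
    have "((\<lambda>s. complex_of_real (s powr real N * (1 - s) powr (\<alpha> - 1))) has_integral of_real (Beta (real N + 1) \<alpha>)) {0..1}"
      by (intro has_integral_of_real has_integral_Beta_powr) (use \<alpha> in auto)
    hence "(beta_kernel \<alpha> (of_nat N) has_integral of_real (Beta (real N + 1) \<alpha>)) {0..1}"
    proof (rule has_integral_eq[rotated])
      fix s :: real assume "s \<in> {0..1}"
      thus "complex_of_real (s powr real N * (1 - s) powr (\<alpha> - 1)) = beta_kernel \<alpha> (of_nat N) s"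
        using powr_of_real[of s "real N"] by (simp add: beta_kernel_def)
    qed
    thus ?thesis by (rule integral_unique)
  qed
  have Bpos: "Beta (real N + 1) \<alpha> > 0" for N
    using \<alpha> by (simp add: Beta_def Gamma_real_pos)
  \<comment> \<open>The extra factor 1 - s turns \<alpha> into \<alpha> + 1, and Beta(N+1,
    \<alpha>+1) is Beta(N+1, \<alpha>) times \<alpha> / (N+1+\<alpha>), so the relative error tends
    to 0.\<close>
  have diff: "norm (?I N - ?J N) \<le> norm \<gamma> * Beta (real N + 1) (\<alpha> + 1)" for N
  proof -
    have "?I N - ?J N = integral {0..1} (\<lambda>s. beta_kernel \<alpha> (\<gamma> + of_nat N) s - beta_kernel \<alpha> (of_nat N) s)"
      by (intro integral_diff[symmetric] beta_kernel_integrable) (use \<alpha> \<gamma> in auto)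
    also have "norm \<dots> \<le> integral {0..1} (\<lambda>s. norm \<gamma> * (s powr real N * (1 - s) powr (\<alpha> + 1 - 1)))"
    proof (rule integral_norm_bound_integral)
      show "(\<lambda>s. beta_kernel \<alpha> (\<gamma> + of_nat N) s - beta_kernel \<alpha> (of_nat N) s) integrable_on {0..1}"
        by (intro integrable_diff beta_kernel_integrable) (use \<alpha> \<gamma> in auto)
      show "(\<lambda>s. norm \<gamma> * (s powr real N * (1 - s) powr (\<alpha> + 1 - 1))) integrable_on {0..1}"
        using has_integral_mult_right[OF has_integral_Beta_powr[of "\<alpha> + 1" "real N"], of "norm \<gamma>"] \<alpha>
        by (auto simp: integrable_on_def)
      fix s :: real assume s: "s \<in> {0..1}"
      have "beta_kernel \<alpha> (\<gamma> + of_nat N) s - beta_kernel \<alpha> (of_nat N) s =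
          beta_kernel \<alpha> (of_nat N) s * (of_real s powr \<gamma> - 1)"
        by (simp add: beta_kernel_def powr_add algebra_simps)
      hence "norm (beta_kernel \<alpha> (\<gamma> + of_nat N) s - beta_kernel \<alpha> (of_nat N) s) =
          (s powr real N * (1 - s) powr (\<alpha> - 1)) * norm (of_real s powr \<gamma> - 1)"
        using s by (simp add: norm_mult norm_beta_kernel)
      also have "\<dots> \<le> (s powr real N * (1 - s) powr (\<alpha> - 1)) * (norm \<gamma> * (1 - s))"
        using s \<gamma> by (intro mult_left_mono norm_powr_minus_1_le) auto
      also have "\<dots> = norm \<gamma> * (s powr real N * ((1 - s) * (1 - s) powr (\<alpha> - 1)))" by simp
      also have "(1 - s) * (1 - s) powr (\<alpha> - 1) = (1 - s) powr (\<alpha> + 1 - 1)"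
        using s \<alpha> by (cases "s = 1") (auto simp: powr_diff)
      finally show "norm (beta_kernel \<alpha> (\<gamma> + of_nat N) s - beta_kernel \<alpha> (of_nat N) s) \<le>
          norm \<gamma> * (s powr real N * (1 - s) powr (\<alpha> + 1 - 1))" .
    qed
    also have "\<dots> = norm \<gamma> * Beta (real N + 1) (\<alpha> + 1)"
      by (intro integral_unique has_integral_mult_right has_integral_Beta_powr) (use \<alpha> in auto)
    finally show ?thesis .
  qed
  have "(\<lambda>N. ?I N / ?J N - 1) \<longlonglongrightarrow> 0"
  proof (rule Lim_null_comparison)
    show "\<forall>\<^sub>F N in sequentially. norm (?I N / ?J N - 1) \<le> norm \<gamma> * \<alpha> / real (Suc N)"
    proof (rule always_eventually, rule allI)
      fix N
      have "(real N + 1 + \<alpha>) * Beta (real N + 1) (\<alpha> + 1) = \<alpha> * Beta (real N + 1) \<alpha>"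
        by (rule Beta_plus1_right) (use \<alpha> in \<open>auto elim!: nonpos_Ints_cases\<close>)
      hence B: "Beta (real N + 1) (\<alpha> + 1) = \<alpha> * Beta (real N + 1) \<alpha> / (real N + 1 + \<alpha>)"
        using \<alpha> by (simp add: field_simps)
      have "?J N \<noteq> 0" using Bpos[of N] by (simp add: J)
      hence "norm (?I N / ?J N - 1) = norm (?I N - ?J N) / norm (?J N)"
        by (simp add: norm_divide diff_divide_distrib flip: norm_divide)
      also have "\<dots> \<le> norm \<gamma> * Beta (real N + 1) (\<alpha> + 1) / Beta (real N + 1) \<alpha>"
        using diff[of N] Bpos[of N] by (simp add: J divide_right_mono)
      also have "\<dots> = norm \<gamma> * \<alpha> / (real N + 1 + \<alpha>)"
        using Bpos[of N] by (simp add: B)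
      also have "\<dots> \<le> norm \<gamma> * \<alpha> / real (Suc N)"
        using \<alpha> by (intro divide_left_mono) auto
      finally show "norm (?I N / ?J N - 1) \<le> norm \<gamma> * \<alpha> / real (Suc N)" .
    qed
    show "(\<lambda>N. norm \<gamma> * \<alpha> / real (Suc N)) \<longlonglongrightarrow> 0"
      using LIMSEQ_Suc[OF lim_const_over_n[of "norm \<gamma> * \<alpha>"]] by simp
  qed
  from tendsto_add[OF this tendsto_const[of 1]]
  have IJ: "(\<lambda>N. ?I N / ?J N) \<longlonglongrightarrow> 1" by simp
  \<comment> \<open>In the combination below the powers of N cancel. Together with \<open>?C\<close>
    and the ratio of integrals it equals the wanted integral for every N > 0: a constant sequence
    whose limit is known.\<close>
  define A where "A = (\<lambda>\<mu> N. npow_fps \<mu> $ N / of_nat N powr (\<mu> - 1))"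
  have A: "A \<mu> \<longlonglongrightarrow> rGamma \<mu>" for \<mu> unfolding A_def by (rule tendsto_npow_fps)
  have nz: "\<gamma> + 1 \<notin> \<int>\<^sub>\<le>\<^sub>0" "of_real \<alpha> + 1 \<notin> (\<int>\<^sub>\<le>\<^sub>0 :: complex set)"
    using \<alpha> \<gamma> by (auto elim!: nonpos_Ints_cases simp: complex_eq_iff)
  let ?C = "of_real (Gamma \<alpha>) / Gamma (of_real \<alpha> + 1) :: complex"
  have "(\<lambda>N. A (of_real \<alpha> + \<gamma> + 1) N / (A (\<gamma> + 1) N * A (of_real \<alpha> + 1) N) * ?C * (?I N / ?J N)) \<longlonglongrightarrow>
      rGamma (of_real \<alpha> + \<gamma> + 1) / (rGamma (\<gamma> + 1) * rGamma (of_real \<alpha> + 1)) * ?C * 1"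
    using nz by (intro tendsto_intros A IJ) (simp add: rGamma_eq_zero_iff)
  moreover have "\<forall>\<^sub>F N in sequentially. A (of_real \<alpha> + \<gamma> + 1) N / (A (\<gamma> + 1) N * A (of_real \<alpha> + 1) N) * ?C * (?I N / ?J N) =
      integral {0..1} (beta_kernel \<alpha> \<gamma>)"
    using eventually_gt_at_top[of 0]
  proof eventually_elim
    case (elim N)
    have p: "pochhammer (\<gamma> + 1) N \<noteq> 0" "pochhammer (of_real \<alpha> + 1 :: complex) N \<noteq> 0"
      using nz by (auto simp: pochhammer_eq_0_iff)
    have "of_nat N powr (of_real \<alpha> + \<gamma>) = of_nat N powr \<gamma> * (of_nat N powr of_real \<alpha> :: complex)"
      by (simp add: powr_add mult.commute)
    hence AA: "A (of_real \<alpha> + \<gamma> + 1) N / (A (\<gamma> + 1) N * A (of_real \<alpha> + 1) N) =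
       pochhammer (of_real \<alpha> + \<gamma> + 1) N * fact N / (pochhammer (\<gamma> + 1) N * pochhammer (of_real \<alpha> + 1) N)"
      using elim p by (simp add: A_def npow_fps_nth field_simps)
    have "of_real (Beta (real N + 1) \<alpha>) = (Beta (of_nat N + 1) (of_real \<alpha>) :: complex)"
      by (simp add: Beta_complex_of_real[symmetric])
    also have "\<dots> = fact N * of_real (Gamma \<alpha>) / Gamma (of_real \<alpha> + 1 + of_nat N)"
      by (simp add: Beta_def Gamma_fact Gamma_complex_of_real add_ac)
    also have "Gamma (of_real \<alpha> + 1 + of_nat N :: complex) = pochhammer (of_real \<alpha> + 1) N * Gamma (of_real \<alpha> + 1)"
      using pochhammer_Gamma[OF nz(2), of N] nz(2) by (simp add: Gamma_eq_zero_iff)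
    finally have JN: "?J N = fact N * of_real (Gamma \<alpha>) / (pochhammer (of_real \<alpha> + 1) N * Gamma (of_real \<alpha> + 1))"
      by (simp add: J)
    have "Gamma \<alpha> \<noteq> 0" using Gamma_real_pos[OF \<alpha>] by simp
    moreover have "Gamma (of_real \<alpha> + 1 :: complex) \<noteq> 0" using nz(2) by (simp add: Gamma_eq_zero_iff)
    ultimately have "A (of_real \<alpha> + \<gamma> + 1) N / (A (\<gamma> + 1) N * A (of_real \<alpha> + 1) N) * ?C * (?I N / ?J N) =
        pochhammer (of_real \<alpha> + \<gamma> + 1) N * ?I N / pochhammer (\<gamma> + 1) N"
      unfolding AA JN using p by (simp add: field_simps)
    also have "\<dots> = integral {0..1} (beta_kernel \<alpha> \<gamma>)"
      using integral_beta_kernel_poch[of \<alpha> \<gamma> N] \<alpha> \<gamma> p by (simp add: field_simps)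
    finally show ?case .
  qed
  ultimately have "(\<lambda>N. integral {0..1} (beta_kernel \<alpha> \<gamma>)) \<longlonglongrightarrow>
      rGamma (of_real \<alpha> + \<gamma> + 1) / (rGamma (\<gamma> + 1) * rGamma (of_real \<alpha> + 1)) * ?C * 1"
    by (rule Lim_transform_eventually)
  hence "integral {0..1} (beta_kernel \<alpha> \<gamma>) =
      rGamma (of_real \<alpha> + \<gamma> + 1) / (rGamma (\<gamma> + 1) * rGamma (of_real \<alpha> + 1)) * ?C * 1"
    using LIMSEQ_const_iff by blast
  thus ?thesis using nz by (simp add: rGamma_inverse_Gamma Gamma_eq_zero_iff field_simps)
qed

text \<open>Both sides obey the same recurrence in \<beta>, which carries the formula from Re
  \<beta> \<ge> 1 down to Re \<beta> > -1, one unit per step.\<close>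

theorem integral_beta_kernel:
  assumes \<alpha>: "\<alpha> > 0" and \<beta>: "Re \<beta> > -1"
  shows "integral {0..1} (beta_kernel \<alpha> \<beta>) =
           of_real (Gamma \<alpha>) * Gamma (\<beta> + 1) * rGamma (of_real \<alpha> + \<beta> + 1)"
proof -
  have *: "integral {0..1} (beta_kernel \<alpha> \<beta>) =
           of_real (Gamma \<alpha>) * Gamma (\<beta> + 1) * rGamma (of_real \<alpha> + \<beta> + 1)"
    if "Re \<beta> > -1" "Re \<beta> + real M \<ge> 1" for M \<beta>
    using that
  proof (induction M arbitrary: \<beta>)
    case 0
    thus ?case using integral_beta_kernel_large[OF \<alpha>] by simp
  next
    case (Suc M)
    have nz: "\<beta> + 1 \<noteq> 0" "\<beta> + 1 \<notin> \<int>\<^sub>\<le>\<^sub>0"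
      using Suc.prems(1) by (auto elim!: nonpos_Ints_cases simp: complex_eq_iff)
    have "(\<beta> + 1) * integral {0..1} (beta_kernel \<alpha> \<beta>) =
       (of_real \<alpha> + \<beta> + 1) * (of_real (Gamma \<alpha>) * Gamma (\<beta> + 1 + 1) * rGamma (of_real \<alpha> + (\<beta> + 1) + 1))"
      using integral_beta_kernel_rec[OF \<alpha> Suc.prems(1)] Suc.IH[of "\<beta> + 1"] Suc.prems by simp
    also have "\<dots> = of_real (Gamma \<alpha>) * Gamma (\<beta> + 1 + 1) * ((of_real \<alpha> + \<beta> + 1) * rGamma ((of_real \<alpha> + \<beta> + 1) + 1))"
      by (simp add: add_ac mult_ac)
    also have "\<dots> = (\<beta> + 1) * (of_real (Gamma \<alpha>) * Gamma (\<beta> + 1) * rGamma (of_real \<alpha> + \<beta> + 1))"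
      by (simp only: rGamma_plus1 Gamma_plus1[OF nz(2)]) (simp only: mult_ac)
    finally show ?case using nz(1) by simp
  qed
  obtain M :: nat where "1 - Re \<beta> \<le> real M" using real_arch_simple by blast
  thus ?thesis by (intro *[OF \<beta>, of M]) simp
qed

text \<open>The substitution s = x t reduces to the unit interval and collects the exponents
  \<alpha> - 1, \<beta> and 1.\<close>

lemma RL_integral_power_fun:
  assumes "\<alpha> \<ge> 0" "Re \<beta> > -1" "x > 0"
  shows "RL_integral \<alpha> (power_fun \<beta>) x =
           Gamma (\<beta> + 1) * rGamma (of_real \<alpha> + \<beta> + 1) * of_real x powr (of_real \<alpha> + \<beta>)"
proof (cases "\<alpha> = 0")
  case True
  have "\<beta> + 1 \<notin> \<int>\<^sub>\<le>\<^sub>0"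
    using assms(2) by (auto elim!: nonpos_Ints_cases simp: complex_eq_iff)
  thus ?thesis using True assms(3)
    by (simp add: RL_integral_def power_fun_def rGamma_inverse_Gamma Gamma_eq_zero_iff)
next
  case False
  hence \<alpha>: "\<alpha> > 0" using assms by simp
  define I where "I = integral {0..1} (beta_kernel \<alpha> \<beta>)"
  have "(beta_kernel \<alpha> \<beta> has_integral I) {0..1}"
    unfolding I_def by (intro integrable_integral beta_kernel_integrable \<alpha> assms)
  from has_integral_stretch_real[OF this, of "1 / x"]
  have "((\<lambda>s. beta_kernel \<alpha> \<beta> (1 / x * s)) has_integral (of_real x * I)) ((\<lambda>s. s / (1 / x)) ` {0..1})"
    using assms by (simp add: scaleR_conv_of_real)
  moreover have "(\<lambda>s. s / (1 / x)) ` {0..1} = {0..x}"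
    using assms(3) image_mult_atLeastAtMost[of x 0 1] by (simp add: mult.commute)
  ultimately have "((\<lambda>s. beta_kernel \<alpha> \<beta> (1 / x * s)) has_integral (of_real x * I)) {0..x}" by simp
  hence "((\<lambda>s. of_real (x powr (\<alpha> - 1)) * of_real x powr \<beta> * beta_kernel \<alpha> \<beta> (1 / x * s)) has_integral
     (of_real (x powr (\<alpha> - 1)) * of_real x powr \<beta> * (of_real x * I))) {0..x}"
    by (rule has_integral_mult_right)
  hence "((\<lambda>s. of_real ((x - s) powr (\<alpha> - 1)) * power_fun \<beta> s) has_integral
     (of_real (x powr (\<alpha> - 1)) * of_real x powr \<beta> * (of_real x * I))) {0..x}"
  \<comment> \<open>For \<beta> = 0 the integrands differ at s = 0, where \<open>power_fun\<close>
    is 1 but the complex power is 0.\<close>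
  proof (rule has_integral_spike_finite[of "{0}", rotated 2])
    fix s assume "s \<in> {0..x} - {0}"
    hence s: "0 < s" "s \<le> x" by auto
    have "(x - s) powr (\<alpha> - 1) = (x * (1 - s / x)) powr (\<alpha> - 1)"
      using assms(3) by (simp add: right_diff_distrib)
    also have "\<dots> = x powr (\<alpha> - 1) * (1 - s / x) powr (\<alpha> - 1)"
      by (rule powr_mult)
    finally have 1: "(x - s) powr (\<alpha> - 1) = x powr (\<alpha> - 1) * (1 - s / x) powr (\<alpha> - 1)" .
    have "of_real s powr \<beta> = (of_real x * complex_of_real (s / x)) powr \<beta>"
      using assms(3) by simp
    also have "\<dots> = of_real x powr \<beta> * of_real (s / x) powr \<beta>"
      using s assms(3) by (intro powr_times_real) auto
    finally have 2: "of_real s powr \<beta> = of_real x powr \<beta> * complex_of_real (s / x) powr \<beta>" .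
    have "power_fun \<beta> s = of_real s powr \<beta>" using s by (simp add: power_fun_def)
    thus "of_real ((x - s) powr (\<alpha> - 1)) * power_fun \<beta> s =
       of_real (x powr (\<alpha> - 1)) * of_real x powr \<beta> * beta_kernel \<alpha> \<beta> (1 / x * s)"
      by (simp only: 1 2) (simp add: beta_kernel_def mult_ac)
  qed auto
  hence int: "integral {0..x} (\<lambda>s. of_real ((x - s) powr (\<alpha> - 1)) * power_fun \<beta> s) =
      of_real (x powr (\<alpha> - 1)) * of_real x powr \<beta> * (of_real x * I)"
    by (rule integral_unique)
  have "x powr \<alpha> = x powr (\<alpha> - 1) * x" using assms(3) by (simp add: powr_diff)
  hence "of_real x powr (of_real \<alpha> + \<beta>) = of_real (x powr (\<alpha> - 1)) * of_real x * complex_of_real x powr \<beta>"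
    using powr_of_real[of x \<alpha>] assms(3) by (simp add: powr_add)
  moreover have "Gamma \<alpha> \<noteq> 0" using Gamma_real_pos[OF \<alpha>] by simp
  ultimately show ?thesis
    using False integral_beta_kernel[OF \<alpha> assms(2)]
    by (simp add: RL_integral_def int I_def)
qed

text \<open>Stated with \<open>rGamma\<close> because \<gamma> rGamma(\<gamma>+1) = rGamma \<gamma>
  holds at the poles of \<Gamma> too, so a power whose derivative vanishes needs no separate
  case.\<close>

lemma vector_derivative_power:
  fixes f :: "real \<Rightarrow> complex"
  assumes "\<And>x. x > 0 \<Longrightarrow> f x = c * rGamma (\<gamma> + 1) * of_real x powr \<gamma>" "x > 0"
  shows "vector_derivative f (at x) = c * rGamma \<gamma> * of_real x powr (\<gamma> - 1)"
proof -
  have "((\<lambda>x. c * rGamma (\<gamma> + 1) * of_real x powr \<gamma>) has_vector_derivative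
          (c * rGamma (\<gamma> + 1) * (\<gamma> * of_real x powr (\<gamma> - 1)))) (at x)"
    using assms(2)
    by (intro has_vector_derivative_mult_right has_vector_derivative_real_field has_field_derivative_powr) auto
  hence "(f has_vector_derivative (c * rGamma (\<gamma> + 1) * (\<gamma> * of_real x powr (\<gamma> - 1)))) (at x)"
    by (rule has_vector_derivative_transform_within_open[where S = "{0<..}"])
       (use assms in auto)
  also have "c * rGamma (\<gamma> + 1) * (\<gamma> * of_real x powr (\<gamma> - 1)) =
      c * (\<gamma> * rGamma (\<gamma> + 1)) * of_real x powr (\<gamma> - 1)"
    by (simp only: mult_ac)
  finally show ?thesis by (simp only: rGamma_plus1 vector_derivative_at)
qed

lemma funpow_vector_derivative_power:
  fixes f :: "real \<Rightarrow> complex"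
  assumes "\<And>x. x > 0 \<Longrightarrow> f x = c * rGamma (\<gamma> + 1) * of_real x powr \<gamma>" "x > 0"
  shows "((\<lambda>f x. vector_derivative f (at x)) ^^ n) f x =
           c * rGamma (\<gamma> - of_nat n + 1) * of_real x powr (\<gamma> - of_nat n)"
  using assms(2)
proof (induction n arbitrary: x)
  case (Suc n)
  have "vector_derivative (((\<lambda>f x. vector_derivative f (at x)) ^^ n) f) (at x) =
      c * rGamma (\<gamma> - of_nat n) * of_real x powr (\<gamma> - of_nat n - 1)"
    by (rule vector_derivative_power[OF Suc.IH Suc.prems])
  thus ?case by (simp add: algebra_simps)
qed (use assms in auto)

theorem frac_op_power_eq:
  assumes "x > 0"
  shows "frac_op_power \<alpha> \<beta> x =
           Gamma (\<beta> + 1) * rGamma (of_real \<alpha> + \<beta> + 1) * of_real x powr (of_real \<alpha> + \<beta>)"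
proof (cases "Re \<beta> > -1 \<and> \<alpha> < 0")
  case True
  define n where "n = nat \<lceil>-\<alpha>\<rceil>"
  have n: "real n + \<alpha> \<ge> 0" using True unfolding n_def by linarith
  have "frac_op \<alpha> (power_fun \<beta>) x =
      ((\<lambda>f x. vector_derivative f (at x)) ^^ n) (RL_integral (real n + \<alpha>) (power_fun \<beta>)) x"
    using True by (simp add: frac_op_def n_def Let_def)
  also have "\<dots> = Gamma (\<beta> + 1) * rGamma (of_real (real n + \<alpha>) + \<beta> - of_nat n + 1) *
       of_real x powr (of_real (real n + \<alpha>) + \<beta> - of_nat n)"
    by (rule funpow_vector_derivative_power[OF RL_integral_power_fun assms]) (use n True in auto)
  finally show ?thesis using True by (simp add: frac_op_power_def)
next
  case False
  thus ?thesis using RL_integral_power_fun[of \<alpha> \<beta> x] assms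
    by (auto simp: frac_op_power_def frac_op_def)
qed

section \<open>The quadrature error\<close>

lemma gchoose_2: "(a :: complex) gchoose 2 = a * (a - 1) / 2"
  by (simp add: gbinomial_prod_rev numeral_2_eq_2)

lemma growth_npow_nonpos:
  assumes "\<mu> \<in> \<int>\<^sub>\<le>\<^sub>0"
  shows "growth p (npow_fps \<mu>)"
proof -
  obtain j where j: "\<mu> = - of_nat j" using assms by (auto elim: nonpos_Ints_cases')
  show ?thesis
    by (rule growth_eventually[where N = "Suc j" and C = 0])
       (auto simp: npow_fps_nth j pochhammer_eq_0_iff)
qed

text \<open>Two terms of \<open>power_fps_expansion\<close>, normalised by
  \<open>rGamma \<mu>\<close>. At a pole of \<Gamma> the normalised power sequence is 0 and both
  series on the right are polynomials, so the statement persists.\<close>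

lemma rGamma_power_expansion:
  "growth (Re \<mu> - 3) (fps_const (rGamma \<mu>) * power_fps (\<mu> - 1) -
     (npow_fps \<mu> - fps_const (\<mu> / 2) * npow_fps (\<mu> - 1)))"
proof (cases "\<mu> \<in> \<int>\<^sub>\<le>\<^sub>0")
  case True
  moreover from True have "\<mu> - 1 \<in> \<int>\<^sub>\<le>\<^sub>0" by (rule nonpos_Ints_diff_Nats) auto
  moreover from True have "rGamma \<mu> = 0" by (simp add: rGamma_eq_zero_iff)
  ultimately show ?thesis
    by (auto intro!: growth_uminus growth_diff growth_cmult growth_npow_nonpos)
next
  case False
  then obtain c where c: "c 0 = Gamma \<mu>" "c (Suc 0) = - ((\<mu> gchoose 2) * Gamma (\<mu> - 1))"
      "growth (Re (\<mu> - 1) - real 2) (power_fps (\<mu> - 1) -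
        (\<Sum>i<2. fps_const (c i) * npow_fps (\<mu> - 1 + 1 - of_nat i)))"
    using power_fps_expansion[of "\<mu> - 1" 2] by auto
  have r: "rGamma \<mu> * Gamma \<mu> = 1"
    using False by (simp add: rGamma_inverse_Gamma Gamma_eq_zero_iff)
  \<comment> \<open>The defect of the second coefficient against -\<mu>/2. It vanishes except at
    \<mu> = 1, where \<open>Gamma 0 = 0\<close> leaves 1/2; there \<open>npow_fps 0\<close> is a
    constant and harmless.\<close>
  define e where "e = rGamma \<mu> * c (Suc 0) + \<mu> / 2"
  have "growth p (fps_const e * npow_fps (\<mu> - 1))" for p
  proof (cases "\<mu> = 1")
    case True
    thus ?thesis by (simp add: npow_fps_0 growth_cmult growth_const flip: fps_const_1_eq_1)
  next
    case \<mu>: False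
    have "\<mu> - 1 \<notin> \<int>\<^sub>\<le>\<^sub>0"
    proof
      assume "\<mu> - 1 \<in> \<int>\<^sub>\<le>\<^sub>0"
      then obtain j where j: "\<mu> - 1 = - of_nat j" by (auto elim: nonpos_Ints_cases')
      have "j \<noteq> 0"
      proof
        assume "j = 0"
        hence "\<mu> = 1" using j by simp
        thus False using \<mu> by simp
      qed
      with j have "\<mu> = - of_nat (j - 1)" by (simp add: of_nat_diff algebra_simps)
      thus False using False by simp
    qed
    hence "Gamma \<mu> = (\<mu> - 1) * Gamma (\<mu> - 1)" using Gamma_plus1[of "\<mu> - 1"] by simp
    hence "c (Suc 0) = - (\<mu> / 2) * Gamma \<mu>" by (simp add: c gchoose_2)
    hence "e = 0" using r by (simp add: e_def mult.left_commute)
    thus ?thesis by (simp add: growth_0)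
  qed
  moreover have "growth (Re \<mu> - 3) (fps_const (rGamma \<mu>) * (power_fps (\<mu> - 1) -
        (fps_const (Gamma \<mu>) * npow_fps \<mu> + fps_const (c (Suc 0)) * npow_fps (\<mu> - 1))))"
    by (rule growth_cmult) (use c(3) in \<open>simp add: numeral_2_eq_2 c(1)\<close>)
  ultimately have "growth (Re \<mu> - 3) (fps_const (rGamma \<mu>) * (power_fps (\<mu> - 1) -
        (fps_const (Gamma \<mu>) * npow_fps \<mu> + fps_const (c (Suc 0)) * npow_fps (\<mu> - 1))) +
        fps_const e * npow_fps (\<mu> - 1))"
    by (intro growth_add)
  moreover have "fps_const (rGamma \<mu>) * fps_const (Gamma \<mu>) = 1"
    using r by simp
  hence "fps_const (rGamma \<mu>) * (power_fps (\<mu> - 1) -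
        (fps_const (Gamma \<mu>) * npow_fps \<mu> + fps_const (c (Suc 0)) * npow_fps (\<mu> - 1))) +
        fps_const e * npow_fps (\<mu> - 1) =
     fps_const (rGamma \<mu>) * power_fps (\<mu> - 1) - (npow_fps \<mu> - fps_const (\<mu> / 2) * npow_fps (\<mu> - 1))"
    unfolding e_def fps_const_add[symmetric] fps_const_mult[symmetric]
    by (simp add: distrib_right right_diff_distrib distrib_left mult.assoc[symmetric] del: fps_const_mult fps_const_add)
  ultimately show ?thesis by simp
qed

text \<open>The difference is exactly \<open>npow_fps (\<nu> + of_real \<alpha> - 2)\<close> times
  \<open>G\<close>. The two entries of the maximum come from these two factors.\<close>

lemma growth_npow_bt:
  assumes q: "q < -1" "q \<le> \<alpha> - 1" "growth q G"
    and W: "W = npow_fps (of_real \<alpha>) * (1 - fps_const (of_real (\<alpha> / 2)) * (1 - fps_X) +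
       (1 - fps_X) * (1 - fps_X) * G)"
  shows "growth (max (Re \<nu> + \<alpha> - 3) (\<alpha> - 1))
     (npow_fps \<nu> * W - (npow_fps (\<nu> + of_real \<alpha>) - fps_const (of_real (\<alpha> / 2)) * npow_fps (\<nu> + of_real \<alpha> - 1)))"
proof -
  have eq: "npow_fps (\<nu> + of_real \<alpha> - 1 - 1) = npow_fps (\<nu> + of_real \<alpha>) * ((1 - fps_X) * (1 - fps_X))"
    by (simp only: npow_fps_diff_1 mult.assoc)
  have expansion: "npow_fps \<nu> * W - (npow_fps (\<nu> + of_real \<alpha>) - fps_const (of_real (\<alpha> / 2)) * npow_fps (\<nu> + of_real \<alpha> - 1))
      = npow_fps (\<nu> + of_real \<alpha> - 1 - 1) * G"
    unfolding eq W npow_fps_diff_1[of "\<nu> + of_real \<alpha>"] npow_fps_add[of \<nu> "of_real \<alpha>"]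
    by (simp add: algebra_simps)
  have bound: "growth (max (Re (\<nu> + of_real \<alpha> - 1 - 1) - 1) q) (npow_fps (\<nu> + of_real \<alpha> - 1 - 1) * G)"
    by (intro growth_mult growth_npow_fps q)
  have le: "max (Re (\<nu> + of_real \<alpha> - 1 - 1) - 1) q \<le> max (Re \<nu> + \<alpha> - 3) (\<alpha> - 1)"
    using q(2) by (auto simp: le_max_iff_disj)
  show ?thesis unfolding expansion by (rule growth_mono[OF bound le])
qed

text \<open>Pure bookkeeping: \<open>M\<close>, \<open>N\<close>, \<open>N'\<close> will be the
  series of orders \<mu>, \<mu> - 1, \<mu> - 2, and all terms of order \<mu> - 1 are gathered in one
  coefficient of \<open>N\<close>, which is then shown to vanish or to be harmless.\<close>

lemma quadrature_error_identity:
  fixes T P W A B k m c0 c1 S r :: "'a :: comm_ring_1"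
  assumes "P = c0 * A + c1 * B + S + r"
  shows "T - W * P = (T - c0 * (M - m * N)) - c0 * (A * W - (M - k * N)) - c1 * (B * W - (N - k * N')) -
      S * W - W * r + (c0 * k - c0 * m - c1) * N + c1 * (k * N')"
  unfolding assms by (simp add: algebra_simps)

text \<open>The constant \<open>d\<close> is arbitrary because altering the value at node 0 only
  adds a multiple of the weights, which have order \<alpha> - 1.\<close>

lemma growth_quadrature_error:
  assumes \<beta>: "\<beta> + 1 \<notin> \<int>\<^sub>\<le>\<^sub>0"
    and \<theta>: "\<alpha> \<le> 0 \<Longrightarrow> \<theta> < 1 / 2" "\<alpha> > 0 \<Longrightarrow> \<theta> \<le> 1 / 2"
  shows "growth (max (\<alpha> + Re \<beta> - 2) (\<alpha> - 1))
     (fps_const (Gamma (\<beta> + 1) * rGamma (of_real \<alpha> + \<beta> + 1)) * power_fps (of_real \<alpha> + \<beta>) -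
      bt_fps \<alpha> \<theta> * (power_fps \<beta> + fps_const d))"
proof -
  define p where "p = max (\<alpha> + Re \<beta> - 2) (\<alpha> - 1)"
  define W where "W = bt_fps \<alpha> \<theta>"
  define \<mu> where "\<mu> = of_real \<alpha> + \<beta> + 1"
  obtain q G where q: "q < -1" "q \<le> \<alpha> - 1" "growth q G"
    and WG: "W = npow_fps (of_real \<alpha>) * (1 - fps_const (of_real (\<alpha> / 2)) * (1 - fps_X) +
       (1 - fps_X) * (1 - fps_X) * G)"
    using bt_fps_expansion[of \<alpha> \<theta>] \<theta> unfolding W_def by metis
  note conv = growth_npow_bt[OF q WG]
  have npow: "growth s (npow_fps \<nu>)" if "Re \<nu> - 1 \<le> s" for s \<nu>
    using growth_mono[OF growth_npow_fps that] .
  \<comment> \<open>Large enough that the remainder is summable and of order at most \<alpha> - 1,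
    as its convolution with the weights requires. The two further terms in \<open>K\<close> are the
    leading ones, treated separately.\<close>
  obtain K0 :: nat where K0: "Re \<beta> + 2 + \<bar>\<alpha>\<bar> \<le> real K0" using real_arch_simple by blast
  define K where "K = K0 + 2"
  have K: "Re \<beta> - real K < -1" "Re \<beta> - real K \<le> \<alpha> - 1"
    using K0 by (auto simp: K_def)
  obtain c where c: "c 0 = Gamma (\<beta> + 1)" "c (Suc 0) = - ((\<beta> + 1 gchoose 2) * Gamma \<beta>)"
      "growth (Re \<beta> - real K) (power_fps \<beta> - (\<Sum>i<K. fps_const (c i) * npow_fps (\<beta> + 1 - of_nat i)))"
    using power_fps_expansion[OF \<beta>, of K] by blast
  define r where "r = power_fps \<beta> - (\<Sum>i<K. fps_const (c i) * npow_fps (\<beta> + 1 - of_nat i)) + fps_const d"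
  define S where "S = (\<Sum>i<K0. fps_const (c (i + 2)) * npow_fps (\<beta> - 1 - of_nat i))"
  have "(\<Sum>i<K. fps_const (c i) * npow_fps (\<beta> + 1 - of_nat i)) =
      fps_const (c 0) * npow_fps (\<beta> + 1) + fps_const (c (Suc 0)) * npow_fps \<beta> + S"
    by (simp add: K_def S_def sum.lessThan_Suc_shift algebra_simps del: sum.lessThan_Suc)
  hence P: "power_fps \<beta> + fps_const d =
      fps_const (c 0) * npow_fps (\<beta> + 1) + fps_const (c (Suc 0)) * npow_fps \<beta> + S + r"
    by (simp add: r_def)
  have gr: "growth (Re \<beta> - real K) r"
    unfolding r_def by (intro growth_add c(3) growth_const)
  \<comment> \<open>The order of the weights themselves, read off from \<open>conv\<close> at
    exponent 0, where \<open>npow_fps 0\<close> is 1.\<close>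
  have gW: "growth (\<alpha> - 1) W"
  proof -
    have "growth (\<alpha> - 1) (npow_fps 0 * W - (npow_fps (0 + of_real \<alpha>) -
        fps_const (of_real (\<alpha> / 2)) * npow_fps (0 + of_real \<alpha> - 1)))"
      using growth_mono[OF conv[of 0]] by simp
    moreover have "growth (\<alpha> - 1) (npow_fps (0 + of_real \<alpha>) -
        fps_const (of_real (\<alpha> / 2)) * npow_fps (0 + of_real \<alpha> - 1))"
      by (intro growth_diff growth_cmult npow) auto
    ultimately show ?thesis using growth_add[of "\<alpha> - 1"] by (fastforce simp: npow_fps_0)
  qed
  have "growth (max (\<alpha> - 1) (Re \<beta> - real K)) (W * r)"
    by (rule growth_mult[OF gW gr K(1)])
  hence g1: "growth p (W * r)"
    by (rule growth_mono) (use K in \<open>auto simp: p_def\<close>)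
  have g2: "growth p (fps_const (rGamma \<mu>) * power_fps (\<mu> - 1) -
       (npow_fps \<mu> - fps_const (\<mu> / 2) * npow_fps (\<mu> - 1)))"
    by (rule growth_mono[OF rGamma_power_expansion]) (simp add: \<mu>_def p_def)
  have g3: "growth p (npow_fps (\<beta> + 1) * W - (npow_fps \<mu> - fps_const (of_real (\<alpha> / 2)) * npow_fps (\<mu> - 1)))"
    using growth_mono[OF conv[of "\<beta> + 1"], of p] by (simp add: \<mu>_def p_def add_ac)
  have g4: "growth p (npow_fps \<beta> * W - (npow_fps (\<mu> - 1) - fps_const (of_real (\<alpha> / 2)) * npow_fps (\<mu> - 2)))"
  proof -
    have "\<beta> + of_real \<alpha> = \<mu> - 1" "\<beta> + of_real \<alpha> - 1 = \<mu> - 2" by (simp_all add: \<mu>_def)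
    moreover have "max (Re \<beta> + \<alpha> - 3) (\<alpha> - 1) \<le> p" by (auto simp: p_def le_max_iff_disj)
    ultimately show ?thesis using growth_mono[OF conv[of \<beta>]] by metis
  qed
  have g5: "growth p (S * W)"
  proof -
    have "growth p (npow_fps (\<beta> - 1 - of_nat i) * W)" for i
    proof -
      let ?\<nu> = "\<beta> - 1 - of_nat i"
      have "growth p (npow_fps ?\<nu> * W - (npow_fps (?\<nu> + of_real \<alpha>) -
          fps_const (of_real (\<alpha> / 2)) * npow_fps (?\<nu> + of_real \<alpha> - 1)) +
          (npow_fps (?\<nu> + of_real \<alpha>) - fps_const (of_real (\<alpha> / 2)) * npow_fps (?\<nu> + of_real \<alpha> - 1)))"
        by (intro growth_add growth_mono[OF conv] growth_diff growth_cmult npow) (auto simp: p_def)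
      thus ?thesis by simp
    qed
    thus ?thesis unfolding S_def sum_distrib_right mult.assoc by (intro growth_sum growth_cmult)
  qed
  \<comment> \<open>The total coefficient at order \<mu> - 1. For \<beta> = 0 it is -1/2 instead of
    0, since c 1 = 0 there; but then \<open>npow_fps (\<mu> - 1)\<close> has order \<alpha> - 1,
    which the bound admits.\<close>
  define e where "e = Gamma (\<beta> + 1) * of_real (\<alpha> / 2) - Gamma (\<beta> + 1) * (\<mu> / 2) - c (Suc 0)"
  have g6: "growth p (fps_const e * npow_fps (\<mu> - 1))"
  proof (cases "\<beta> = 0")
    case True
    thus ?thesis by (intro growth_cmult npow) (simp add: \<mu>_def p_def)
  next
    case False
    have "\<beta> \<notin> \<int>\<^sub>\<le>\<^sub>0"
    proof
      assume "\<beta> \<in> \<int>\<^sub>\<le>\<^sub>0"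
      then obtain j where j: "\<beta> = - of_nat j" by (auto elim: nonpos_Ints_cases')
      with False have "j \<noteq> 0" by auto
      with j have "\<beta> + 1 = - of_nat (j - 1)" by (simp add: of_nat_diff algebra_simps)
      thus False using \<beta> by simp
    qed
    hence "Gamma (\<beta> + 1) = \<beta> * Gamma \<beta>" by (rule Gamma_plus1)
    hence "e = 0" by (simp add: e_def c gchoose_2 \<mu>_def field_simps)
    thus ?thesis by (simp add: growth_0)
  qed
  have g7: "growth p (npow_fps (\<mu> - 2))" by (intro npow) (simp add: \<mu>_def p_def)
  let ?T = "fps_const (Gamma (\<beta> + 1)) * (fps_const (rGamma \<mu>) * power_fps (\<mu> - 1))"
  note identity = quadrature_error_identity[OF P, where T = ?T and W = W and M = "npow_fps \<mu>" and
      N = "npow_fps (\<mu> - 1)" and N' = "npow_fps (\<mu> - 2)" and m = "fps_const (\<mu> / 2)" and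
      k = "fps_const (of_real (\<alpha> / 2))"]
  have main: "?T - fps_const (c 0) * (npow_fps \<mu> - fps_const (\<mu> / 2) * npow_fps (\<mu> - 1)) =
      fps_const (c 0) * (fps_const (rGamma \<mu>) * power_fps (\<mu> - 1) -
        (npow_fps \<mu> - fps_const (\<mu> / 2) * npow_fps (\<mu> - 1)))"
    by (simp only: c(1) right_diff_distrib)
  have e: "fps_const (c 0) * fps_const (of_real (\<alpha> / 2)) - fps_const (c 0) * fps_const (\<mu> / 2) -
      fps_const (c (Suc 0)) = fps_const e"
    by (simp add: e_def c(1))
  have "growth p (?T - W * (power_fps \<beta> + fps_const d))"
    unfolding identity main e
    by (intro growth_add growth_diff growth_cmult g1 g2 g3 g4 g5 g6 g7)
  thus ?thesis by (simp add: \<mu>_def W_def p_def mult.assoc flip: fps_const_mult)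
qed

lemma powr_max_le:
  fixes x :: real
  shows "x powr max a b \<le> x powr a + x powr b"
  by (simp add: max_def)

theorem theorem3p3:
  fixes \<alpha> \<theta> L :: real
  assumes "\<alpha> \<le> 0 \<Longrightarrow> \<theta> < 1 / 2"
    and "\<alpha> > 0 \<Longrightarrow> \<theta> \<le> 1 / 2"
  shows "convergent_of_order_2 L \<alpha> (bt_weight \<alpha> \<theta>)"
  unfolding convergent_of_order_2_def
proof (intro allI impI)
  fix \<beta> :: complex
  assume \<beta>: "\<forall>m::nat. m \<ge> 1 \<longrightarrow> \<beta> \<noteq> - of_nat m"
  have \<beta>': "\<beta> + 1 \<notin> \<int>\<^sub>\<le>\<^sub>0"
  proof
    assume "\<beta> + 1 \<in> \<int>\<^sub>\<le>\<^sub>0"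
    then obtain j where "\<beta> + 1 = - of_nat j" by (auto elim: nonpos_Ints_cases')
    hence "\<beta> = - of_nat j - 1" by (metis add_diff_cancel_right')
    hence "\<beta> = - of_nat (Suc j)" by simp
    thus False using \<beta> by (metis le_add1 plus_1_eq_Suc)
  qed
  \<comment> \<open>The contribution of node 0: it turns the library value 0 of
    \<open>0 powr 0\<close> into 1 and changes nothing for \<beta> \<noteq> 0.\<close>
  define d :: complex where "d = (if \<beta> = 0 then 1 else 0)"
  define E where "E = fps_const (Gamma (\<beta> + 1) * rGamma (of_real \<alpha> + \<beta> + 1)) * power_fps (of_real \<alpha> + \<beta>) -
      bt_fps \<alpha> \<theta> * (power_fps \<beta> + fps_const d)"
  obtain C where C: "C \<ge> 0" "\<And>n. n \<ge> 1 \<Longrightarrow> norm (E $ n) \<le> C * real n powr (max (\<alpha> + Re \<beta> - 2) (\<alpha> - 1))"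
    using growth_leD[OF growth_quadrature_error[OF \<beta>' assms, where d = d]] unfolding E_def by blast
  have pf: "power_fun \<beta> (real j * h) = of_real h powr \<beta> * (power_fps \<beta> + fps_const d) $ j"
    if "h > 0" for j :: nat and h :: real
  proof -
    have "of_real (real j * h) powr \<beta> = of_real (real j) powr \<beta> * complex_of_real h powr \<beta>"
      unfolding of_real_mult using that by (intro powr_times_real) auto
    thus ?thesis using that
      by (cases "j = 0") (auto simp: power_fun_def power_fps_nth d_def mult.commute)
  qed
  show "\<exists>C. \<forall>n\<ge>1. \<forall>h>0. real n * h \<le> L \<longrightarrow>
      norm (frac_op_power \<alpha> \<beta> (real n * h) - conv_quad (bt_weight \<alpha> \<theta>) \<alpha> h n (power_fun \<beta>))
        \<le> C * ((real n * h) powr (\<alpha> + Re \<beta> - 2) * h ^ 2 + (real n * h) powr (\<alpha> - 1) * h powr (Re \<beta> + 1))"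
  proof (intro exI[of _ C] allI impI)
    fix n :: nat and h :: real
    assume n: "n \<ge> 1" and h: "h > 0"
    have hp: "of_real h powr (of_real \<alpha> + \<beta>) = of_real (h powr \<alpha>) * complex_of_real h powr \<beta>"
      using powr_of_real[of h \<alpha>] h by (simp add: powr_add)
    have nh: "complex_of_real (real n * h) powr (of_real \<alpha> + \<beta>) =
        of_real h powr (of_real \<alpha> + \<beta>) * of_nat n powr (of_real \<alpha> + \<beta>)"
      unfolding of_real_mult using h by (subst powr_times_real) auto
    have "conv_quad (bt_weight \<alpha> \<theta>) \<alpha> h n (power_fun \<beta>) =
        of_real (h powr \<alpha>) * (of_real h powr \<beta> * (\<Sum>j=0..n. (power_fps \<beta> + fps_const d) $ j * bt_fps \<alpha> \<theta> $ (n - j)))"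
      unfolding conv_quad_def pf[OF h] sum_distrib_left by (simp add: bt_fps_def mult_ac)
    also have "\<dots> = of_real h powr (of_real \<alpha> + \<beta>) * (bt_fps \<alpha> \<theta> * (power_fps \<beta> + fps_const d)) $ n"
      by (simp only: hp mult.assoc fps_mult_nth[symmetric] mult.commute[of "bt_fps \<alpha> \<theta>"])
    finally have quad: "conv_quad (bt_weight \<alpha> \<theta>) \<alpha> h n (power_fun \<beta>) =
        of_real h powr (of_real \<alpha> + \<beta>) * (bt_fps \<alpha> \<theta> * (power_fps \<beta> + fps_const d)) $ n" .
    have "frac_op_power \<alpha> \<beta> (real n * h) =
        of_real h powr (of_real \<alpha> + \<beta>) *
          (fps_const (Gamma (\<beta> + 1) * rGamma (of_real \<alpha> + \<beta> + 1)) * power_fps (of_real \<alpha> + \<beta>)) $ n"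
      using n h by (subst frac_op_power_eq) (simp_all only: nh power_fps_nth fps_mult_left_const_nth, simp_all)
    hence "frac_op_power \<alpha> \<beta> (real n * h) - conv_quad (bt_weight \<alpha> \<theta>) \<alpha> h n (power_fun \<beta>) =
        of_real h powr (of_real \<alpha> + \<beta>) * E $ n"
      by (simp only: quad E_def fps_sub_nth right_diff_distrib)
    hence "norm (frac_op_power \<alpha> \<beta> (real n * h) - conv_quad (bt_weight \<alpha> \<theta>) \<alpha> h n (power_fun \<beta>)) =
        h powr (\<alpha> + Re \<beta>) * norm (E $ n)"
      using h norm_powr_real_powr[of "of_real h" "of_real \<alpha> + \<beta>"] by (simp add: norm_mult)
    also have "\<dots> \<le> h powr (\<alpha> + Re \<beta>) * (C * (real n powr (\<alpha> + Re \<beta> - 2) + real n powr (\<alpha> - 1)))"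
      using order_trans[OF C(2)[OF n] mult_left_mono[OF powr_max_le C(1)]]
      by (intro mult_left_mono) auto
    \<comment> \<open>Homogeneity: both error terms carry the common factor h powr (\<alpha> + Re
      \<beta>), so the constant found for h = 1 serves every step size.\<close>
    also have "\<dots> = C * ((real n * h) powr (\<alpha> + Re \<beta> - 2) * h ^ 2 + (real n * h) powr (\<alpha> - 1) * h powr (Re \<beta> + 1))"
    proof -
      have "(real n * h) powr (\<alpha> + Re \<beta> - 2) * h ^ 2 = real n powr (\<alpha> + Re \<beta> - 2) * h powr (\<alpha> + Re \<beta>)"
        using h by (simp add: powr_mult powr_diff)
      moreover have "(real n * h) powr (\<alpha> - 1) * h powr (Re \<beta> + 1) = real n powr (\<alpha> - 1) * h powr (\<alpha> + Re \<beta>)"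
        using h by (simp add: powr_mult powr_add[symmetric])
      ultimately show ?thesis by (simp only: distrib_left mult_ac)
    qed
    finally show "norm (frac_op_power \<alpha> \<beta> (real n * h) - conv_quad (bt_weight \<alpha> \<theta>) \<alpha> h n (power_fun \<beta>))
        \<le> C * ((real n * h) powr (\<alpha> + Re \<beta> - 2) * h ^ 2 + (real n * h) powr (\<alpha> - 1) * h powr (Re \<beta> + 1))" .
  qed
qed

end
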